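(* Let $r$ be an infinite regular cardinal. Let $F:\mathcal{B}\to\mathcal{C}$ and $G:\mathcal{B}\to\mathcal{D}$ be functors, with $\mathcal{B}$ small and $\mathcal{C},\mathcal{D}$ locally small. Suppose that $G$ satisfies the Weak Pullback Condition (WPC), and that $\mathcal{B}$ has products of size $<r$ and that these are preserved by $G$. Then, for any object $d\in\mathcal{D}$, with $X_d=\mathcal{D}(d,G(-)):\mathcal{B}\to\mathsf{Set}$, the left Kan extension $\mathrm{Lan}_F X_d:\mathcal{C}\to\mathsf{Set}$ preserves all products of size $<r$ that exist in $\mathcal{C}$.
   Context: A product of size $<r$ is a product of a family of objects indexed by a set of cardinality $<r$ (including the empty family). A functor $G:\mathcal{B}\to\mathcal{D}$ satisfies the Weak Pullback Condition (WPC) if every cospan $x\xrightarrow{f} z\xleftarrow{g} y$ in $\mathcal{B}$ can be completed to a commutative square $f\cdot p=g\cdot q$ (with $p:w\to x$, $q:w\to y$ in $\mathcal{B}$) that $G$ transforms into a weak pullback diagram in $\mathcal{D}$, where a weak pullback has the existence but not necessarily the uniqueness part of the universal property of a pullback. For a functor $X:\mathcal{B}\to\mathsf{Set}$, the left Kan extension of $X$ along $F$ is the (pointwise) functor $\mathrm{Lan}_FX:\mathcal{C}\to\mathsf{Set}$, $c\mapsto\mathrm{colim}\,(X V_{F,c})$, where $F/c$ is the comma category of pairs $(b,z)$ with $b\in\mathcal{B}$ and $z:Fb\to c$ in $\mathcal{C}$ (morphisms $f:(b,z)\to(b',z')$ being maps $f:b\to b'$ with $z'\cdot Ff=z$) and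 $V_{F,c}:F/c\to\mathcal{B}$ is the forgetful functor. *)

theory Defs
  imports "HOL-Library.FuncSet"
begin

unbundle cardinal_syntax

section \<open>Categories and functors\<close>

record ('o, 'm) category =
  Obj :: "'o set"
  Arr :: "'m set"
  Dom :: "'m \<Rightarrow> 'o"
  Cod :: "'m \<Rightarrow> 'o"
  Ide :: "'o \<Rightarrow> 'm"
  Cmp :: "'m \<Rightarrow> 'm \<Rightarrow> 'm"  (infixl \<open>\<cdot>\<index>\<close> 70)

definition hom :: "('o, 'm, 'e) category_scheme \<Rightarrow> 'o \<Rightarrow> 'o \<Rightarrow> 'm set" where
  "hom C x y = {f \<in> Arr C. Dom C f = x \<and> Cod C f = y}"

text \<open>
  Objects and arrows of a category form sets (over arbitrary types), so smallness and
  local smallness hold automatically. Composition is unconstrained on non-composable pairs.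
\<close>

locale category =
  fixes C :: "('o, 'm, 'e) category_scheme" (structure)
  assumes Dom_in_Obj: "f \<in> Arr C \<Longrightarrow> Dom C f \<in> Obj C"
    and Cod_in_Obj: "f \<in> Arr C \<Longrightarrow> Cod C f \<in> Obj C"
    and Ide_in_hom: "x \<in> Obj C \<Longrightarrow> Ide C x \<in> hom C x x"
    and Cmp_in_hom: "f \<in> hom C x y \<Longrightarrow> g \<in> hom C y z \<Longrightarrow> g \<cdot> f \<in> hom C x z"
    and Ide_left: "f \<in> hom C x y \<Longrightarrow> Ide C y \<cdot> f = f"
    and Ide_right: "f \<in> hom C x y \<Longrightarrow> f \<cdot> Ide C x = f"
    and Cmp_assoc: "f \<in> hom C w x \<Longrightarrow> g \<in> hom C x y \<Longrightarrow> h \<in> hom C y z \<Longrightarrow>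
                      (h \<cdot> g) \<cdot> f = h \<cdot> (g \<cdot> f)"

record ('o, 'm, 'o2, 'm2) fctr =
  FObj :: "'o \<Rightarrow> 'o2"
  FArr :: "'m \<Rightarrow> 'm2"

locale cat_functor = B: category B + C: category C
  for B :: "('o, 'm, 'e) category_scheme"
    and C :: "('o2, 'm2, 'e2) category_scheme" +
  fixes F :: "('o, 'm, 'o2, 'm2) fctr"
  assumes FObj_in_Obj: "x \<in> Obj B \<Longrightarrow> FObj F x \<in> Obj C"
    and FArr_in_hom: "f \<in> hom B x y \<Longrightarrow> FArr F f \<in> hom C (FObj F x) (FObj F y)"
    and FArr_Ide: "x \<in> Obj B \<Longrightarrow> FArr F (Ide B x) = Ide C (FObj F x)"
    and FArr_Cmp: "f \<in> hom B x y \<Longrightarrow> g \<in> hom B y z \<Longrightarrow>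
                     FArr F (g \<cdot>\<^bsub>B\<^esub> f) = FArr F g \<cdot>\<^bsub>C\<^esub> FArr F f"

definition fctr_comp ::
  "('o2, 'm2, 'o3, 'm3) fctr \<Rightarrow> ('o, 'm, 'o2, 'm2) fctr \<Rightarrow> ('o, 'm, 'o3, 'm3) fctr" where
  "fctr_comp G F = \<lparr> FObj = FObj G \<circ> FObj F, FArr = FArr G \<circ> FArr F \<rparr>"

section \<open>Products and weak pullbacks\<close>

definition is_product ::
  "('o, 'm, 'e) category_scheme \<Rightarrow> 'i set \<Rightarrow> ('i \<Rightarrow> 'o) \<Rightarrow> 'o \<Rightarrow> ('i \<Rightarrow> 'm) \<Rightarrow> bool" where
  "is_product C I a c p \<longleftrightarrow>
     (\<forall>i\<in>I. a i \<in> Obj C) \<and> c \<in> Obj C \<and> (\<forall>i\<in>I. p i \<in> hom C c (a i)) \<and>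
     (\<forall>x\<in>Obj C. \<forall>f. (\<forall>i\<in>I. f i \<in> hom C x (a i)) \<longrightarrow>
        (\<exists>!h. h \<in> hom C x c \<and> (\<forall>i\<in>I. p i \<cdot>\<^bsub>C\<^esub> h = f i)))"

text \<open>
  The type argument fixes the type from which index sets are drawn. Every set of
  cardinality below \<open>r :: 'r rel\<close> is in bijection with a subset of \<open>Field r\<close>, so for
  \<open>'i = 'r\<close> these predicates speak about all products of size \<open>< r\<close>.
\<close>

definition has_products_below ::
  "'i itself \<Rightarrow> 'r rel \<Rightarrow> ('o, 'm, 'e) category_scheme \<Rightarrow> bool" where
  "has_products_below (_ :: 'i itself) r C \<longleftrightarrow>
     (\<forall>(I :: 'i set) a. |I| <o r \<longrightarrow> (\<forall>i\<in>I. a i \<in> Obj C) \<longrightarrow> (\<exists>c p. is_product C I a c p))"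

definition preserves_products_below ::
  "'i itself \<Rightarrow> 'r rel \<Rightarrow> ('o, 'm, 'e) category_scheme \<Rightarrow> ('o2, 'm2, 'e2) category_scheme \<Rightarrow>
     ('o, 'm, 'o2, 'm2) fctr \<Rightarrow> bool" where
  "preserves_products_below (_ :: 'i itself) r C D F \<longleftrightarrow>
     (\<forall>(I :: 'i set) a c p. |I| <o r \<longrightarrow> is_product C I a c p \<longrightarrow>
        is_product D I (\<lambda>i. FObj F (a i)) (FObj F c) (\<lambda>i. FArr F (p i)))"

text \<open>In a square, \<open>p : w \<rightarrow> x\<close> and \<open>q : w \<rightarrow> y\<close> lie over the cospan \<open>f : x \<rightarrow> z\<close>, \<open>g : y \<rightarrow> z\<close>.\<close>

definition commutative_square ::
  "('o, 'm, 'e) category_scheme \<Rightarrow> 'm \<Rightarrow> 'm \<Rightarrow> 'm \<Rightarrow> 'm \<Rightarrow> bool" where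
  "commutative_square C f g p q \<longleftrightarrow>
     (\<exists>w x y z. f \<in> hom C x z \<and> g \<in> hom C y z \<and> p \<in> hom C w x \<and> q \<in> hom C w y) \<and>
     f \<cdot>\<^bsub>C\<^esub> p = g \<cdot>\<^bsub>C\<^esub> q"

definition weak_pullback ::
  "('o, 'm, 'e) category_scheme \<Rightarrow> 'm \<Rightarrow> 'm \<Rightarrow> 'm \<Rightarrow> 'm \<Rightarrow> bool" where
  "weak_pullback C f g p q \<longleftrightarrow>
     commutative_square C f g p q \<and>
     (\<forall>u v. commutative_square C f g u v \<longrightarrow>
        (\<exists>h \<in> hom C (Dom C u) (Dom C p). p \<cdot>\<^bsub>C\<^esub> h = u \<and> q \<cdot>\<^bsub>C\<^esub> h = v))"

definition weak_pullback_condition ::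
  "('o, 'm, 'e) category_scheme \<Rightarrow> ('o2, 'm2, 'e2) category_scheme \<Rightarrow>
     ('o, 'm, 'o2, 'm2) fctr \<Rightarrow> bool" where
  "weak_pullback_condition B D G \<longleftrightarrow>
     (\<forall>f\<in>Arr B. \<forall>g\<in>Arr B. Cod B f = Cod B g \<longrightarrow>
        (\<exists>p q. commutative_square B f g p q \<and>
               weak_pullback D (FArr G f) (FArr G g) (FArr G p) (FArr G q)))"

section \<open>The category of sets and representable functors\<close>

text \<open>
  Arrows are triples of domain, extensional function and codomain. The objects are the
  sets over the type \<open>'u\<close>.
\<close>

type_synonym 'u set_arrow = "'u set \<times> ('u \<Rightarrow> 'u) \<times> 'u set"

definition fun_of :: "'u set_arrow \<Rightarrow> 'u \<Rightarrow> 'u" where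
  "fun_of f = fst (snd f)"

definition set_cat :: "('u set, 'u set_arrow) category" where
  "set_cat =
     \<lparr> Obj = UNIV,
       Arr = {(A, f, A'). f \<in> A \<rightarrow>\<^sub>E A'},
       Dom = fst,
       Cod = (\<lambda>f. snd (snd f)),
       Ide = (\<lambda>A. (A, restrict id A, A)),
       Cmp = (\<lambda>g f. (fst f, compose (fst f) (fun_of g) (fun_of f), snd (snd g))) \<rparr>"

definition hom_functor :: "('o, 'm, 'e) category_scheme \<Rightarrow> 'o \<Rightarrow> ('o, 'm, 'm set, 'm set_arrow) fctr" where
  "hom_functor D d =
     \<lparr> FObj = hom D d,
       FArr = (\<lambda>k. (hom D d (Dom D k), (\<lambda>h \<in> hom D d (Dom D k). k \<cdot>\<^bsub>D\<^esub> h), hom D d (Cod D k))) \<rparr>"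

lemma in_hom_set_cat:
  "f \<in> hom set_cat A A' \<longleftrightarrow> (\<exists>g \<in> A \<rightarrow>\<^sub>E A'. f = (A, g, A'))"
  by (cases f) (auto simp: hom_def set_cat_def)

lemma in_hom_set_catD:
  assumes "f \<in> hom set_cat A A'"
  shows "f = (A, fun_of f, A')" "fun_of f \<in> A \<rightarrow>\<^sub>E A'"
  using assms by (auto simp: in_hom_set_cat fun_of_def)

lemma triple_in_hom_set_cat:
  "(A, g, A') \<in> hom set_cat x y \<longleftrightarrow> A = x \<and> A' = y \<and> g \<in> x \<rightarrow>\<^sub>E y"
  by (auto simp: in_hom_set_cat)

lemma Obj_set_cat: "Obj set_cat = UNIV"
  by (simp add: set_cat_def)

lemma Cmp_set_cat:
  "(A', g, A'') \<cdot>\<^bsub>set_cat\<^esub> (A, f, A') = (A, compose A g f, A'')"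
  by (simp add: set_cat_def fun_of_def)

lemma category_set_cat: "category (set_cat :: ('u set, 'u set_arrow) category)"
proof
  show "Ide set_cat x \<in> hom set_cat x x" for x :: "'u set"
    by (simp add: in_hom_set_cat, simp add: set_cat_def)
  show "Ide set_cat y \<cdot>\<^bsub>set_cat\<^esub> f = f" if "f \<in> hom set_cat x y" for f and x y :: "'u set"
    using in_hom_set_catD[OF that]
    by (cases f) (auto simp: set_cat_def fun_of_def compose_def fun_eq_iff PiE_iff extensional_def)
  show "f \<cdot>\<^bsub>set_cat\<^esub> Ide set_cat x = f" if "f \<in> hom set_cat x y" for f and x y :: "'u set"
    using in_hom_set_catD[OF that]
    by (cases f) (auto simp: set_cat_def fun_of_def compose_def fun_eq_iff PiE_iff extensional_def)
  show "g \<cdot>\<^bsub>set_cat\<^esub> f \<in> hom set_cat x z"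
    if f: "f \<in> hom set_cat x y" and g: "g \<in> hom set_cat y z" for f g and x y z :: "'u set"
  proof -
    from f g obtain f' g' where "f = (x, f', y)" "g = (y, g', z)" "f' \<in> x \<rightarrow>\<^sub>E y" "g' \<in> y \<rightarrow>\<^sub>E z"
      by (auto simp: in_hom_set_cat)
    then show ?thesis by (auto simp: Cmp_set_cat in_hom_set_cat compose_def PiE_iff intro!: bexI)
  qed
  show "h \<cdot>\<^bsub>set_cat\<^esub> g \<cdot>\<^bsub>set_cat\<^esub> f = h \<cdot>\<^bsub>set_cat\<^esub> (g \<cdot>\<^bsub>set_cat\<^esub> f)"
    if "f \<in> hom set_cat w x" "g \<in> hom set_cat x y" "h \<in> hom set_cat y z"
    for f g h and w x y z :: "'u set"
    using that by (auto simp: in_hom_set_cat Cmp_set_cat compose_def fun_eq_iff)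
qed (auto simp: set_cat_def)

text \<open>
  Products in \<^const>\<open>set_cat\<close> are cartesian products, whatever the underlying type: it
  suffices to test the universal property on singletons.
\<close>

lemma is_product_set_cat_iff:
  fixes c :: "'u set"
  shows "is_product set_cat I a c p \<longleftrightarrow>
     (\<forall>i\<in>I. p i \<in> hom set_cat c (a i)) \<and>
     bij_betw (\<lambda>x. \<lambda>i\<in>I. fun_of (p i) x) c (\<Pi>\<^sub>E i\<in>I. a i)"
proof (cases "\<forall>i\<in>I. p i \<in> hom set_cat c (a i)")
  case True
  define e where "e = (\<lambda>x. \<lambda>i\<in>I. fun_of (p i) x)"
  have p: "p i = (c, fun_of (p i), a i)" "fun_of (p i) \<in> c \<rightarrow>\<^sub>E a i" if "i \<in> I" for i
    using True that in_hom_set_catD by blast+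
  have pc: "p i \<cdot>\<^bsub>set_cat\<^esub> (x, h, c) = (x, (\<lambda>t\<in>x. fun_of (p i) (h t)), a i)" if "i \<in> I" for i x h
    by (subst p(1)[OF that]) (simp add: Cmp_set_cat compose_def)
  have "is_product set_cat I a c p \<longleftrightarrow> bij_betw e c (\<Pi>\<^sub>E i\<in>I. a i)"
  proof
    assume P: "is_product set_cat I a c p"
    define one :: "'u set" where "one = {undefined}"
    have ex1e: "\<exists>!x. x \<in> c \<and> e x = y" if y: "y \<in> (\<Pi>\<^sub>E i\<in>I. a i)" for y
    proof -
      define f where "f i = (one, (\<lambda>t\<in>one. y i), a i)" for i
      have "\<forall>i\<in>I. f i \<in> hom set_cat one (a i)"
        using y by (auto simp: in_hom_set_cat f_def)
      then have ex1: "\<exists>!h. h \<in> hom set_cat one c \<and> (\<forall>i\<in>I. p i \<cdot>\<^bsub>set_cat\<^esub> h = f i)"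
        using P by (simp add: is_product_def set_cat_def)
      have iff: "x \<in> c \<and> e x = y \<longleftrightarrow>
          (one, (\<lambda>t\<in>one. x), c) \<in> hom set_cat one c \<and>
          (\<forall>i\<in>I. p i \<cdot>\<^bsub>set_cat\<^esub> (one, (\<lambda>t\<in>one. x), c) = f i)" for x
        using y by (auto simp: triple_in_hom_set_cat pc f_def e_def one_def fun_eq_iff PiE_iff extensional_def)
      from ex1 obtain h where h: "h \<in> hom set_cat one c" "\<forall>i\<in>I. p i \<cdot>\<^bsub>set_cat\<^esub> h = f i"
        by blast
      then obtain g where g: "g \<in> one \<rightarrow>\<^sub>E c" "h = (one, g, c)"
        by (auto simp: in_hom_set_cat)
      have "h = (one, (\<lambda>t\<in>one. g undefined), c)"
        using g by (auto simp: one_def fun_eq_iff PiE_iff extensional_def)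
      with h iff have 1: "g undefined \<in> c \<and> e (g undefined) = y" by metis
      show ?thesis
      proof (rule ex1I[of _ "g undefined"])
        fix x assume "x \<in> c \<and> e x = y"
        with 1 iff ex1 have "(one, (\<lambda>t\<in>one. x), c) = (one, (\<lambda>t\<in>one. g undefined), c)" by metis
        then show "x = g undefined" by (auto simp: one_def dest!: fun_cong[of _ _ undefined])
      qed (rule 1)
    qed
    have e: "e x \<in> (\<Pi>\<^sub>E i\<in>I. a i)" if "x \<in> c" for x
      using p that by (auto simp: e_def)
    show "bij_betw e c (\<Pi>\<^sub>E i\<in>I. a i)"
    proof (rule bij_betwI')
      show "e x = e x' \<longleftrightarrow> x = x'" if "x \<in> c" "x' \<in> c" for x x'
        using ex1e[OF e[OF that(1)]] that by auto
      show "\<exists>x\<in>c. y = e x" if "y \<in> (\<Pi>\<^sub>E i\<in>I. a i)" for y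
        using ex1e[OF that] by auto
    qed (rule e)
  next
    assume bij: "bij_betw e c (\<Pi>\<^sub>E i\<in>I. a i)"
    have "\<exists>!h. h \<in> hom set_cat x c \<and> (\<forall>i\<in>I. p i \<cdot>\<^bsub>set_cat\<^esub> h = f i)"
      if f: "\<forall>i\<in>I. f i \<in> hom set_cat x (a i)" for x f
    proof -
      have fi: "f i = (x, fun_of (f i), a i)" "fun_of (f i) \<in> x \<rightarrow>\<^sub>E a i" if "i \<in> I" for i
        using f that in_hom_set_catD by blast+
      define y where "y = (\<lambda>t. \<lambda>i\<in>I. fun_of (f i) t)"
      have y: "y t \<in> (\<Pi>\<^sub>E i\<in>I. a i)" if "t \<in> x" for t
        using fi(2) that by (auto simp: y_def)
      define g where "g = (\<lambda>t\<in>x. inv_into c e (y t))"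
      have g: "g t \<in> c" "e (g t) = y t" if "t \<in> x" for t
        using bij y[OF that] that
        by (auto simp: g_def bij_betw_def inv_into_into f_inv_into_f)
      have iff: "p i \<cdot>\<^bsub>set_cat\<^esub> (x, k, c) = f i \<longleftrightarrow> (\<forall>t\<in>x. e (k t) i = y t i)" if i: "i \<in> I" for i k
        using fi(2)[OF i] i
        by (subst fi(1)[OF i]) (auto simp: pc e_def y_def fun_eq_iff PiE_iff extensional_def)
      show ?thesis
      proof (rule ex1I[of _ "(x, g, c)"])
        show "(x, g, c) \<in> hom set_cat x c \<and> (\<forall>i\<in>I. p i \<cdot>\<^bsub>set_cat\<^esub> (x, g, c) = f i)"
          using g iff by (auto simp: in_hom_set_cat g_def)
        fix h assume h: "h \<in> hom set_cat x c \<and> (\<forall>i\<in>I. p i \<cdot>\<^bsub>set_cat\<^esub> h = f i)"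
        then obtain k where k: "k \<in> x \<rightarrow>\<^sub>E c" "h = (x, k, c)" by (auto simp: in_hom_set_cat)
        have "e (k t) = e (g t)" if "t \<in> x" for t
        proof (rule extensionalityI[where A = I])
          fix i assume "i \<in> I"
          with h k iff that have "e (k t) i = y t i" by blast
          then show "e (k t) i = e (g t) i" using g(2)[OF that] by simp
        qed (auto simp: e_def)
        then have "k t = g t" if "t \<in> x" for t
          using that bij g(1) k(1) by (metis bij_betw_imp_inj_on inj_onD PiE_mem)
        then have "k = g"
          using k(1) by (auto simp: g_def fun_eq_iff PiE_iff extensional_def)
        then show "h = (x, g, c)" using k(2) by simp
      qed
    qed
    then show "is_product set_cat I a c p"
      using True by (auto simp: is_product_def set_cat_def)
  qed
  with True show ?thesis by (simp add: e_def)
qed (auto simp: is_product_def)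

lemma cat_functor_hom_functor:
  assumes "category D" "d \<in> Obj D"
  shows "cat_functor D set_cat (hom_functor D d)"
proof -
  interpret category D by fact
  interpret S: category "set_cat :: ('m set, 'm set_arrow) category" by (rule category_set_cat)
  show ?thesis
  proof
    fix f g x y z assume f: "f \<in> hom D x y" and g: "g \<in> hom D y z"
    from Cmp_in_hom[OF f g]
    have "Dom D f = x" "Cod D f = y" "Dom D g = y" "Cod D g = z"
      "Dom D (g \<cdot>\<^bsub>D\<^esub> f) = x" "Cod D (g \<cdot>\<^bsub>D\<^esub> f) = z"
      using f g by (auto simp: hom_def)
    then show "FArr (hom_functor D d) (g \<cdot>\<^bsub>D\<^esub> f) =
        FArr (hom_functor D d) g \<cdot>\<^bsub>set_cat\<^esub> FArr (hom_functor D d) f"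
      using Cmp_in_hom[OF _ f] Cmp_assoc[OF _ f g]
      by (auto simp: hom_functor_def set_cat_def fun_of_def compose_def fun_eq_iff)
  next
    fix f x y assume f: "f \<in> hom D x y"
    then have "Dom D f = x" "Cod D f = y" by (auto simp: hom_def)
    then show "FArr (hom_functor D d) f \<in>
        hom set_cat (FObj (hom_functor D d) x) (FObj (hom_functor D d) y)"
      using Cmp_in_hom[OF _ f] by (auto simp: hom_functor_def in_hom_set_cat)
  next
    fix x assume "x \<in> Obj D"
    from Ide_in_hom[OF this] have "Dom D (Ide D x) = x" "Cod D (Ide D x) = x"
      by (auto simp: hom_def)
    then show "FArr (hom_functor D d) (Ide D x) = Ide set_cat (FObj (hom_functor D d) x)"
      using Ide_left by (auto simp: hom_functor_def set_cat_def fun_eq_iff)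
  qed (auto simp: set_cat_def)
qed

lemma cat_functor_fctr_comp:
  assumes "cat_functor B C F" "cat_functor C D G"
  shows "cat_functor B D (fctr_comp G F)"
proof -
  interpret F: cat_functor B C F by fact
  interpret G: cat_functor C D G by fact
  show ?thesis
  proof
    show "FArr (fctr_comp G F) (g \<cdot>\<^bsub>B\<^esub> f) = FArr (fctr_comp G F) g \<cdot>\<^bsub>D\<^esub> FArr (fctr_comp G F) f"
      if "f \<in> hom B x y" "g \<in> hom B y z" for f g x y z
      using F.FArr_Cmp[OF that] G.FArr_Cmp[OF that[THEN F.FArr_in_hom]] by (simp add: fctr_comp_def)
  qed (auto simp: fctr_comp_def F.FObj_in_Obj G.FObj_in_Obj F.FArr_Ide G.FArr_Ide
        intro!: F.FArr_in_hom G.FArr_in_hom)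
qed

section \<open>Colimits of sets\<close>

definition colim_elems :: "('j, 'k, 'e) category_scheme \<Rightarrow> ('j, 'k, 'u set, 'u set_arrow) fctr \<Rightarrow> ('j \<times> 'u) set" where
  "colim_elems J Y = (SIGMA j:Obj J. FObj Y j)"

definition colim_step :: "('j, 'k, 'e) category_scheme \<Rightarrow> ('j, 'k, 'u set, 'u set_arrow) fctr \<Rightarrow> ('j \<times> 'u) rel" where
  "colim_step J Y =
     {((Dom J u, x), (Cod J u, fun_of (FArr Y u) x)) | u x. u \<in> Arr J \<and> x \<in> FObj Y (Dom J u)}"

text \<open>The equivalence relation on \<^term>\<open>colim_elems J Y\<close> generated by \<^term>\<open>colim_step J Y\<close>.\<close>

definition colim_rel :: "('j, 'k, 'e) category_scheme \<Rightarrow> ('j, 'k, 'u set, 'u set_arrow) fctr \<Rightarrow> ('j \<times> 'u) rel" where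
  "colim_rel J Y = Restr ((colim_step J Y \<union> (colim_step J Y)\<inverse>)\<^sup>*) (colim_elems J Y)"

definition set_colim :: "('j, 'k, 'e) category_scheme \<Rightarrow> ('j, 'k, 'u set, 'u set_arrow) fctr \<Rightarrow> ('j \<times> 'u) set set" where
  "set_colim J Y = colim_elems J Y // colim_rel J Y"

definition colim_inj :: "('j, 'k, 'e) category_scheme \<Rightarrow> ('j, 'k, 'u set, 'u set_arrow) fctr \<Rightarrow> 'j \<Rightarrow> 'u \<Rightarrow> ('j \<times> 'u) set" where
  "colim_inj J Y j x = colim_rel J Y `` {(j, x)}"

lemma equiv_colim_rel: "equiv (colim_elems J Y) (colim_rel J Y)"
proof (rule equivI)
  show "colim_rel J Y \<subseteq> colim_elems J Y \<times> colim_elems J Y"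
    by (auto simp: colim_rel_def)
  show "refl_on (colim_elems J Y) (colim_rel J Y)"
    by (auto simp: colim_rel_def refl_on_def)
  have "sym ((colim_step J Y \<union> (colim_step J Y)\<inverse>)\<^sup>*)"
    by (intro sym_rtrancl sym_Un_converse)
  then show "sym (colim_rel J Y)"
    by (auto simp: colim_rel_def sym_def)
  show "trans (colim_rel J Y)"
    unfolding colim_rel_def by (rule trans_Restr) (rule trans_rtrancl)
qed

text \<open>\<^const>\<open>set_colim\<close> is a colimit among sets over every type.\<close>

lemma colim_inj_cocone:
  assumes "cat_functor J set_cat Y"
  shows "j \<in> Obj J \<Longrightarrow> x \<in> FObj Y j \<Longrightarrow> colim_inj J Y j x \<in> set_colim J Y"
    and "u \<in> Arr J \<Longrightarrow> x \<in> FObj Y (Dom J u) \<Longrightarrow>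
           colim_inj J Y (Cod J u) (fun_of (FArr Y u) x) = colim_inj J Y (Dom J u) x"
proof -
  interpret cat_functor J set_cat Y by fact
  show "j \<in> Obj J \<Longrightarrow> x \<in> FObj Y j \<Longrightarrow> colim_inj J Y j x \<in> set_colim J Y"
    by (auto simp: colim_inj_def set_colim_def colim_elems_def intro!: quotientI)
  assume u: "u \<in> Arr J" and x: "x \<in> FObj Y (Dom J u)"
  from FArr_in_hom[of u "Dom J u" "Cod J u"] u
  have "FArr Y u \<in> hom set_cat (FObj Y (Dom J u)) (FObj Y (Cod J u))" by (simp add: hom_def)
  then have "fun_of (FArr Y u) x \<in> FObj Y (Cod J u)"
    using x by (auto simp: hom_def set_cat_def fun_of_def PiE_iff)
  moreover have "((Dom J u, x), (Cod J u, fun_of (FArr Y u) x)) \<in> colim_step J Y"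
    using u x by (auto simp: colim_step_def)
  ultimately have "((Dom J u, x), (Cod J u, fun_of (FArr Y u) x)) \<in> colim_rel J Y"
    using u x B.Dom_in_Obj B.Cod_in_Obj by (auto simp: colim_rel_def colim_elems_def)
  then show "colim_inj J Y (Cod J u) (fun_of (FArr Y u) x) = colim_inj J Y (Dom J u) x"
    unfolding colim_inj_def using equiv_class_eq[OF equiv_colim_rel] by metis
qed

lemma set_colim_universal:
  assumes fct: "cat_functor J set_cat Y"
    and mem: "\<And>j x. j \<in> Obj J \<Longrightarrow> x \<in> FObj Y j \<Longrightarrow> t j x \<in> T"
    and coc: "\<And>u x. u \<in> Arr J \<Longrightarrow> x \<in> FObj Y (Dom J u) \<Longrightarrow>
                t (Cod J u) (fun_of (FArr Y u) x) = t (Dom J u) x"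
  shows "\<exists>!h. h \<in> set_colim J Y \<rightarrow>\<^sub>E T \<and>
              (\<forall>j\<in>Obj J. \<forall>x\<in>FObj Y j. h (colim_inj J Y j x) = t j x)"
proof -
  define h where "h = (\<lambda>K \<in> set_colim J Y. (case (SOME e. e \<in> K) of (j, x) \<Rightarrow> t j x))"
  have inv: "case_prod t a = case_prod t b"
    if "(a, b) \<in> (colim_step J Y \<union> (colim_step J Y)\<inverse>)\<^sup>*" for a b
    using that
  proof (induction rule: rtrancl_induct)
    case (step y z)
    then show ?case by (auto simp: colim_step_def coc)
  qed simp
  have h: "h (colim_inj J Y j x) = t j x" if "j \<in> Obj J" "x \<in> FObj Y j" for j x
  proof -
    have "(j, x) \<in> colim_inj J Y j x"
      using that by (auto simp: colim_inj_def colim_rel_def colim_elems_def)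
    then have "(SOME e. e \<in> colim_inj J Y j x) \<in> colim_inj J Y j x" by (rule someI)
    then have "((j, x), SOME e. e \<in> colim_inj J Y j x) \<in> (colim_step J Y \<union> (colim_step J Y)\<inverse>)\<^sup>*"
      by (auto simp: colim_inj_def colim_rel_def)
    from inv[OF this] show ?thesis
      using that colim_inj_cocone(1)[OF fct, of j x] by (simp add: h_def)
  qed
  have rep: "\<exists>j\<in>Obj J. \<exists>x\<in>FObj Y j. K = colim_inj J Y j x" if "K \<in> set_colim J Y" for K
    using that by (auto simp: set_colim_def colim_elems_def colim_inj_def elim!: quotientE)
  show ?thesis
  proof (rule ex1I[of _ h])
    have "h K \<in> T" if "K \<in> set_colim J Y" for K
      using rep[OF that] h mem by force
    then have "h \<in> set_colim J Y \<rightarrow>\<^sub>E T"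
      by (auto simp: PiE_iff h_def extensional_def)
    with h show "h \<in> set_colim J Y \<rightarrow>\<^sub>E T \<and> (\<forall>j\<in>Obj J. \<forall>x\<in>FObj Y j. h (colim_inj J Y j x) = t j x)"
      by blast
    fix g
    assume g: "g \<in> set_colim J Y \<rightarrow>\<^sub>E T \<and> (\<forall>j\<in>Obj J. \<forall>x\<in>FObj Y j. g (colim_inj J Y j x) = t j x)"
    show "g = h"
    proof (rule PiE_ext[of g _ "\<lambda>_. T" h])
      show "g K = h K" if "K \<in> set_colim J Y" for K
        using rep[OF that] g h by auto
    qed (use g \<open>h \<in> _\<close> in auto)
  qed
qed

section \<open>Comma categories and left Kan extensions of set-valued functors\<close>

text \<open>An arrow of the comma category is stored together with its source and target.\<close>

definition comma ::
  "('o, 'm, 'e) category_scheme \<Rightarrow> ('o2, 'm2, 'e2) category_scheme \<Rightarrow> ('o, 'm, 'o2, 'm2) fctr \<Rightarrow> 'o2 \<Rightarrow>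
     ('o \<times> 'm2, ('o \<times> 'm2) \<times> 'm \<times> ('o \<times> 'm2)) category" where
  "comma B C F c =
     \<lparr> Obj = {(b, z). b \<in> Obj B \<and> z \<in> hom C (FObj F b) c},
       Arr = {((b, z), f, (b', z')).
                b \<in> Obj B \<and> z \<in> hom C (FObj F b) c \<and>
                b' \<in> Obj B \<and> z' \<in> hom C (FObj F b') c \<and>
                f \<in> hom B b b' \<and> z' \<cdot>\<^bsub>C\<^esub> FArr F f = z},
       Dom = fst,
       Cod = (\<lambda>u. snd (snd u)),
       Ide = (\<lambda>(b, z). ((b, z), Ide B b, (b, z))),
       Cmp = (\<lambda>v u. (fst u, fst (snd v) \<cdot>\<^bsub>B\<^esub> fst (snd u), snd (snd v))) \<rparr>"

definition comma_forget :: "('o \<times> 'm2, ('o \<times> 'm2) \<times> 'm \<times> ('o \<times> 'm2), 'o, 'm) fctr" where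
  "comma_forget = \<lparr> FObj = fst, FArr = (\<lambda>u. fst (snd u)) \<rparr>"

lemma in_hom_comma:
  "f \<in> hom (comma B C F c) x y \<longleftrightarrow>
     (\<exists>u \<in> hom B (fst x) (fst y). f = (x, u, y) \<and> snd y \<cdot>\<^bsub>C\<^esub> FArr F u = snd x) \<and>
     fst x \<in> Obj B \<and> snd x \<in> hom C (FObj F (fst x)) c \<and>
     fst y \<in> Obj B \<and> snd y \<in> hom C (FObj F (fst y)) c"
  unfolding hom_def[of "comma B C F c"] unfolding comma_def
  by (cases f; cases x; cases y) auto

lemma Cmp_comma: "(y, v, z) \<cdot>\<^bsub>comma B C F c\<^esub> (x, u, y) = (x, v \<cdot>\<^bsub>B\<^esub> u, z)"
  by (simp add: comma_def)

lemma category_comma: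
  assumes "cat_functor B C F"
  shows "category (comma B C F c)"
proof -
  interpret cat_functor B C F by fact
  show ?thesis
  proof
    fix x y z f g
    assume f: "f \<in> hom (comma B C F c) x y" and g: "g \<in> hom (comma B C F c) y z"
    obtain u v where
      u: "f = (x, u, y)" "u \<in> hom B (fst x) (fst y)" "snd y \<cdot>\<^bsub>C\<^esub> FArr F u = snd x" and
      v: "g = (y, v, z)" "v \<in> hom B (fst y) (fst z)" "snd z \<cdot>\<^bsub>C\<^esub> FArr F v = snd y" and
      z: "snd z \<in> hom C (FObj F (fst z)) c"
      using f g unfolding in_hom_comma by blast
    have "snd z \<cdot>\<^bsub>C\<^esub> FArr F (v \<cdot>\<^bsub>B\<^esub> u) = snd x"
      using C.Cmp_assoc[OF FArr_in_hom[OF u(2)] FArr_in_hom[OF v(2)] z] u v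
      by (simp add: FArr_Cmp[OF u(2) v(2)])
    then show "g \<cdot>\<^bsub>comma B C F c\<^esub> f \<in> hom (comma B C F c) x z"
      using f g B.Cmp_in_hom[OF u(2) v(2)] by (auto simp: in_hom_comma Cmp_comma u v)
  next
    fix f g h w x y z
    assume "f \<in> hom (comma B C F c) w x" "g \<in> hom (comma B C F c) x y" "h \<in> hom (comma B C F c) y z"
    then show "h \<cdot>\<^bsub>comma B C F c\<^esub> g \<cdot>\<^bsub>comma B C F c\<^esub> f =
        h \<cdot>\<^bsub>comma B C F c\<^esub> (g \<cdot>\<^bsub>comma B C F c\<^esub> f)"
      by (auto simp: in_hom_comma Cmp_comma B.Cmp_assoc)
  next
    fix x assume "x \<in> Obj (comma B C F c)"
    then show "Ide (comma B C F c) x \<in> hom (comma B C F c) x x"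
      by (auto simp: in_hom_comma) (auto simp: comma_def B.Ide_in_hom FArr_Ide C.Ide_right)
  next
    fix f x y assume "f \<in> hom (comma B C F c) x y"
    then show "Ide (comma B C F c) y \<cdot>\<^bsub>comma B C F c\<^esub> f = f"
      and "f \<cdot>\<^bsub>comma B C F c\<^esub> Ide (comma B C F c) x = f"
      by (auto simp: in_hom_comma) (auto simp: comma_def B.Ide_left B.Ide_right split: prod.splits)
  qed (auto simp: comma_def)
qed

lemma cat_functor_comma_forget:
  assumes "cat_functor B C F"
  shows "cat_functor (comma B C F c) B comma_forget"
proof -
  interpret cat_functor B C F by fact
  interpret K: category "comma B C F c" by (rule category_comma) fact
  show ?thesis
    by unfold_locales (auto simp: in_hom_comma Cmp_comma comma_forget_def, auto simp: comma_def)
qed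

abbreviation comma_diagram ::
  "('o, 'm, 'u set, 'u set_arrow) fctr \<Rightarrow>
     ('o \<times> 'm2, ('o \<times> 'm2) \<times> 'm \<times> ('o \<times> 'm2), 'u set, 'u set_arrow) fctr" where
  "comma_diagram X \<equiv> fctr_comp X comma_forget"

text \<open>
  An arrow \<open>k : c \<rightarrow> c'\<close> induces the map of colimits sending the class of \<open>((b, z), x)\<close> to
  the class of \<open>((b, k \<cdot> z), x)\<close>. All representatives contribute the same class, so the
  union below is just that class (cf. \<open>lan_FArr\<close>).
\<close>

definition lan ::
  "('o, 'm, 'e) category_scheme \<Rightarrow> ('o2, 'm2, 'e2) category_scheme \<Rightarrow> ('o, 'm, 'o2, 'm2) fctr \<Rightarrow>
     ('o, 'm, 'u set, 'u set_arrow) fctr \<Rightarrow>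
     ('o2, 'm2, (('o \<times> 'm2) \<times> 'u) set set, (('o \<times> 'm2) \<times> 'u) set set_arrow) fctr" where
  "lan B C F X =
     (let L = (\<lambda>c. set_colim (comma B C F c) (comma_diagram X)) in
     \<lparr> FObj = L,
       FArr = (\<lambda>k. (L (Dom C k),
                    (\<lambda>K \<in> L (Dom C k). \<Union>((b, z), x) \<in> K.
                       colim_inj (comma B C F (Cod C k)) (comma_diagram X) (b, k \<cdot>\<^bsub>C\<^esub> z) x),
                    L (Cod C k))) \<rparr>)"

context
  fixes B :: "('o, 'm, 'e) category_scheme" and C :: "('o2, 'm2, 'e2) category_scheme"
    and F and X :: "('o, 'm, 'u set, 'u set_arrow) fctr"
  assumes F: "cat_functor B C F" and X: "cat_functor B set_cat X"
begin

interpretation F: cat_functor B C F by (rule F)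
interpretation X: cat_functor B set_cat X by (rule X)

lemma cat_functor_comma_diagram: "cat_functor (comma B C F c) set_cat (comma_diagram X)"
  by (rule cat_functor_fctr_comp[OF cat_functor_comma_forget[OF F] X])

lemma lan_elemE:
  assumes "K \<in> FObj (lan B C F X) c"
  obtains b z x where "b \<in> Obj B" "z \<in> hom C (FObj F b) c" "x \<in> FObj X b"
    "K = colim_inj (comma B C F c) (comma_diagram X) (b, z) x"
proof -
  obtain j x where "j \<in> Obj (comma B C F c)" "x \<in> FObj (comma_diagram X) j" "K = colim_inj (comma B C F c) (comma_diagram X) j x"
    using assms by (auto simp: lan_def set_colim_def colim_elems_def colim_inj_def elim!: quotientE)
  then show thesis
    by (intro that[of "fst j" "snd j" x]) (auto simp: comma_def fctr_comp_def comma_forget_def)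
qed

lemma lan_FArr:
  assumes k: "k \<in> hom C c c'"
    and b: "b \<in> Obj B" and z: "z \<in> hom C (FObj F b) c" and x: "x \<in> FObj X b"
  shows "fun_of (FArr (lan B C F X) k) (colim_inj (comma B C F c) (comma_diagram X) (b, z) x) =
           colim_inj (comma B C F c') (comma_diagram X) (b, k \<cdot>\<^bsub>C\<^esub> z) x"
proof -
  define t where "t j y = colim_inj (comma B C F c') (comma_diagram X) (fst j, k \<cdot>\<^bsub>C\<^esub> snd j) y" for j y
  have coc: "t (Cod (comma B C F c) u) (fun_of (FArr (comma_diagram X) u) y) = t (Dom (comma B C F c) u) y"
    if u: "u \<in> Arr (comma B C F c)" and y: "y \<in> FObj (comma_diagram X) (Dom (comma B C F c) u)" for u y
  proof -
    obtain b1 z1 f b2 z2 where uu: "u = ((b1, z1), f, (b2, z2))" by (metis surj_pair)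
    have f: "f \<in> hom B b1 b2" "z2 \<cdot>\<^bsub>C\<^esub> FArr F f = z1" "z1 \<in> hom C (FObj F b1) c"
      "z2 \<in> hom C (FObj F b2) c" "b1 \<in> Obj B" "b2 \<in> Obj B"
      using u by (auto simp: comma_def uu)
    define u' where "u' = ((b1, k \<cdot>\<^bsub>C\<^esub> z1), f, (b2, k \<cdot>\<^bsub>C\<^esub> z2))"
    have u': "u' \<in> Arr (comma B C F c')"
      using f F.C.Cmp_in_hom[OF f(3) k] F.C.Cmp_in_hom[OF f(4) k]
        F.C.Cmp_assoc[OF F.FArr_in_hom[OF f(1)] f(4) k]
      by (auto simp: comma_def u'_def)
    show ?thesis
      using colim_inj_cocone(2)[OF cat_functor_comma_diagram u', of y] y
      by (simp add: t_def uu u'_def comma_def fctr_comp_def comma_forget_def)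
  qed
  let ?K = "colim_inj (comma B C F c) (comma_diagram X) (b, z) x"
  have mem: "((b, z), x) \<in> ?K"
    using b z x by (auto simp: colim_inj_def colim_rel_def colim_elems_def comma_def
        fctr_comp_def comma_forget_def)
  have const: "case_prod t e = t (b, z) x" if "e \<in> ?K" for e
  proof -
    have "(((b, z), x), e) \<in> (colim_step (comma B C F c) (comma_diagram X) \<union> (colim_step (comma B C F c) (comma_diagram X))\<inverse>)\<^sup>*"
      using that by (auto simp: colim_inj_def colim_rel_def)
    then show ?thesis
    proof (induction rule: rtrancl_induct)
      case (step v w)
      then obtain u y where "u \<in> Arr (comma B C F c)" "y \<in> FObj (comma_diagram X) (Dom (comma B C F c) u)"
        and "(v = (Dom (comma B C F c) u, y) \<and> w = (Cod (comma B C F c) u, fun_of (FArr (comma_diagram X) u) y)) \<or>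
             (w = (Dom (comma B C F c) u, y) \<and> v = (Cod (comma B C F c) u, fun_of (FArr (comma_diagram X) u) y))"
        unfolding colim_step_def by blast
      then show ?case using coc step.IH by (metis case_prod_conv)
    qed simp
  qed
  have "?K \<in> set_colim (comma B C F c) (comma_diagram X)"
    using colim_inj_cocone(1)[OF cat_functor_comma_diagram, of "(b, z)" c x] b z x
    by (simp add: comma_def fctr_comp_def comma_forget_def)
  moreover have "Dom C k = c" "Cod C k = c'" using k by (auto simp: hom_def)
  ultimately have "fun_of (FArr (lan B C F X) k) ?K = (\<Union>e\<in>?K. case_prod t e)"
    by (simp add: lan_def Let_def fun_of_def t_def split_def)
  also have "\<dots> = (\<Union>e\<in>?K. t (b, z) x)"
    using const by (intro SUP_cong) auto
  also have "\<dots> = t (b, z) x" using mem by auto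
  finally show ?thesis by (simp add: t_def)
qed

lemma lan_inj_in:
  assumes "b \<in> Obj B" "z \<in> hom C (FObj F b) c" "x \<in> FObj X b"
  shows "colim_inj (comma B C F c) (comma_diagram X) (b, z) x \<in> FObj (lan B C F X) c"
  using colim_inj_cocone(1)[OF cat_functor_comma_diagram, of "(b, z)" c x] assms
  by (simp add: comma_def fctr_comp_def comma_forget_def lan_def)

lemma FArr_lan_in_hom:
  assumes k: "k \<in> hom C c c'"
  shows "FArr (lan B C F X) k \<in> hom set_cat (FObj (lan B C F X) c) (FObj (lan B C F X) c')"
proof -
  let ?L = "lan B C F X"
  have dc: "Dom C k = c" "Cod C k = c'" using k by (auto simp: hom_def)
  have "fun_of (FArr ?L k) K \<in> FObj ?L c'" if "K \<in> FObj ?L c" for K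
    using that by (elim lan_elemE) (simp add: lan_FArr[OF k] lan_inj_in F.C.Cmp_in_hom[OF _ k])
  moreover have "fun_of (FArr ?L k) \<in> extensional (FObj ?L c)"
    "FArr ?L k = (FObj ?L c, fun_of (FArr ?L k), FObj ?L c')"
    by (auto simp: lan_def Let_def fun_of_def dc)
  ultimately show ?thesis unfolding in_hom_set_cat by (intro bexI) (auto simp: PiE_iff)
qed

lemma cat_functor_lan: "cat_functor C set_cat (lan B C F X)"
proof -
  let ?L = "lan B C F X"
  have ext: "f = g" if hom: "f \<in> hom set_cat (FObj ?L c) A" "g \<in> hom set_cat (FObj ?L c) A"
    and eq: "\<And>b z x. b \<in> Obj B \<Longrightarrow> z \<in> hom C (FObj F b) c \<Longrightarrow> x \<in> FObj X b \<Longrightarrow>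
       fun_of f (colim_inj (comma B C F c) (comma_diagram X) (b, z) x) = fun_of g (colim_inj (comma B C F c) (comma_diagram X) (b, z) x)"
    for f g c A
  proof -
    obtain f' g' where fg: "f' \<in> FObj ?L c \<rightarrow>\<^sub>E A" "g' \<in> FObj ?L c \<rightarrow>\<^sub>E A"
      "f = (FObj ?L c, f', A)" "g = (FObj ?L c, g', A)"
      using hom by (auto simp: in_hom_set_cat)
    have "f' = g'"
      by (rule PiE_ext[OF fg(1,2)], elim lan_elemE) (use eq in \<open>auto simp: fg fun_of_def\<close>)
    then show ?thesis by (simp add: fg)
  qed
  interpret S: category "set_cat :: ((('o \<times> 'm2) \<times> 'u) set set, (('o \<times> 'm2) \<times> 'u) set set_arrow) category"
    by (rule category_set_cat)
  have cmp: "fun_of (g \<cdot>\<^bsub>set_cat\<^esub> f) t = fun_of g (fun_of f t)"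
    if "f \<in> hom set_cat A A'" "t \<in> A" for f g :: "(('o \<times> 'm2) \<times> 'u) set set_arrow" and A A' t
    using that by (auto simp: in_hom_set_cat) (auto simp: set_cat_def fun_of_def compose_def)
  show ?thesis
  proof
    fix c assume c: "c \<in> Obj C"
    note i = F.C.Ide_in_hom[OF c]
    show "FArr ?L (Ide C c) = Ide set_cat (FObj ?L c)"
    proof (rule ext[OF FArr_lan_in_hom[OF i] S.Ide_in_hom])
      fix b z x assume *: "b \<in> Obj B" "z \<in> hom C (FObj F b) c" "x \<in> FObj X b"
      show "fun_of (FArr ?L (Ide C c)) (colim_inj (comma B C F c) (comma_diagram X) (b, z) x) =
          fun_of (Ide set_cat (FObj ?L c)) (colim_inj (comma B C F c) (comma_diagram X) (b, z) x)"
        using lan_inj_in[OF *] by (simp add: lan_FArr[OF i *] F.C.Ide_left[OF *(2)])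
          (simp add: set_cat_def fun_of_def)
    qed (simp add: set_cat_def)
  next
    fix k l c c' c'' assume k: "k \<in> hom C c c'" and l: "l \<in> hom C c' c''"
    note kl = F.C.Cmp_in_hom[OF k l]
    show "FArr ?L (l \<cdot>\<^bsub>C\<^esub> k) = FArr ?L l \<cdot>\<^bsub>set_cat\<^esub> FArr ?L k"
    proof (rule ext[OF FArr_lan_in_hom[OF kl] S.Cmp_in_hom[OF FArr_lan_in_hom[OF k] FArr_lan_in_hom[OF l]]])
      fix b z x assume *: "b \<in> Obj B" "z \<in> hom C (FObj F b) c" "x \<in> FObj X b"
      show "fun_of (FArr ?L (l \<cdot>\<^bsub>C\<^esub> k)) (colim_inj (comma B C F c) (comma_diagram X) (b, z) x) =
          fun_of (FArr ?L l \<cdot>\<^bsub>set_cat\<^esub> FArr ?L k) (colim_inj (comma B C F c) (comma_diagram X) (b, z) x)"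
        by (simp add: cmp[OF FArr_lan_in_hom[OF k] lan_inj_in[OF *]] lan_FArr[OF kl *] lan_FArr[OF k *]
            lan_FArr[OF l *(1) F.C.Cmp_in_hom[OF *(2) k] *(3)] F.C.Cmp_assoc[OF *(2) k l])
    qed
  qed (simp_all add: FArr_lan_in_hom Obj_set_cat)
qed

end

end

theory Submission
  imports Defs
begin

text \<open>
  By the Weak Pullback Condition, two elements \<open>(b, z, x)\<close> and \<open>(b', z', x')\<close> represent the
  same class of the colimit at \<open>c\<close> iff a single span \<open>b \<leftarrow> w \<rightarrow> b'\<close> carrying an element of
  \<open>X w\<close> connects them. Surjectivity of \<open>Lan (\<Prod> c\<^sub>i) \<rightarrow> \<Prod> Lan c\<^sub>i\<close> follows by taking
  the product of the representing objects. For injectivity, given connecting spans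
  \<open>b \<leftarrow> w\<^sub>i \<rightarrow> b'\<close> for all \<open>i\<close>, apply the Weak Pullback Condition to the cospan formed by
  \<open>\<Prod> w\<^sub>i \<rightarrow> (b \<times> b')\<^sup>I\<close> and the diagonal \<open>b \<times> b' \<rightarrow> (b \<times> b')\<^sup>I\<close>: its completion is a single
  span over \<open>b\<close> and \<open>b'\<close> that works for all \<open>i\<close> simultaneously.
\<close>

section \<open>Products\<close>

lemma homD: "f \<in> hom C x y \<Longrightarrow> f \<in> Arr C \<and> Dom C f = x \<and> Cod C f = y"
  by (simp add: hom_def)

lemma is_product_lift:
  assumes "is_product C I a c p" "x \<in> Obj C" "\<And>i. i \<in> I \<Longrightarrow> f i \<in> hom C x (a i)"
  obtains h where "h \<in> hom C x c" "\<And>i. i \<in> I \<Longrightarrow> p i \<cdot>\<^bsub>C\<^esub> h = f i"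
  using assms unfolding is_product_def by blast

text \<open>Projections are jointly monic: both arrows lift the one family of composites of the
  \<open>p i\<close> with \<open>k\<close>, and such a lift is unique.\<close>

lemma is_product_cancel:
  assumes P: "is_product C I a c p" and C: "category C"
    and h: "h \<in> hom C x c" and k: "k \<in> hom C x c"
    and eq: "\<And>i. i \<in> I \<Longrightarrow> p i \<cdot>\<^bsub>C\<^esub> h = p i \<cdot>\<^bsub>C\<^esub> k"
  shows "h = k"
proof -
  interpret category C by fact
  have x: "x \<in> Obj C" using h Dom_in_Obj by (auto simp: hom_def)
  have "\<forall>i\<in>I. p i \<cdot>\<^bsub>C\<^esub> k \<in> hom C x (a i)"
    using P k Cmp_in_hom by (auto simp: is_product_def)
  then have "\<exists>!h. h \<in> hom C x c \<and> (\<forall>i\<in>I. p i \<cdot>\<^bsub>C\<^esub> h = p i \<cdot>\<^bsub>C\<^esub> k)"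
    using P x by (simp add: is_product_def)
  with h k eq show ?thesis by blast
qed

section \<open>Products and change of index type\<close>

lemma is_product_reindex:
  fixes C :: "('o, 'm, 'e) category_scheme" and h :: "'j \<Rightarrow> 'i"
  assumes h: "bij_betw h J I"
  shows "is_product C J (\<lambda>j. a (h j)) c (\<lambda>j. p (h j)) \<longleftrightarrow> is_product C I a c p"
proof -
  have ball: "(\<forall>j\<in>J. Q (h j)) \<longleftrightarrow> (\<forall>i\<in>I. Q i)" for Q
    using h by (auto simp: bij_betw_def)
  \<comment> \<open>Testing on families of the form \<open>f\<close> after \<open>h\<close> loses
    nothing: on \<open>J\<close>, any family agrees with its precomposite by
    \<open>inv_into J h\<close> followed by \<open>h\<close>, and \<open>R\<close> sees only the
    values on \<open>J\<close>.\<close>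
  have all: "(\<forall>f. R (\<lambda>j. f (h j))) \<longleftrightarrow> (\<forall>f. R f)"
    if R: "\<And>f g. (\<And>j. j \<in> J \<Longrightarrow> f j = g j) \<Longrightarrow> R f \<longleftrightarrow> R g" for R :: "('j \<Rightarrow> 'm) \<Rightarrow> bool"
  proof
    assume *: "\<forall>f. R (\<lambda>j. f (h j))"
    show "\<forall>f. R f"
    proof
      fix f
      have "R (\<lambda>j. f (inv_into J h (h j)))"
        using *[rule_format, of "\<lambda>i. f (inv_into J h i)"] .
      then show "R f"
        using R[of "\<lambda>j. f (inv_into J h (h j))" f] h by (auto simp: bij_betw_def)
    qed
  qed blast
  have "(\<forall>f. (\<forall>j\<in>J. f j \<in> hom C x (a (h j))) \<longrightarrow>
          (\<exists>!k. k \<in> hom C x c \<and> (\<forall>j\<in>J. p (h j) \<cdot>\<^bsub>C\<^esub> k = f j))) \<longleftrightarrow>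
        (\<forall>f. (\<forall>i\<in>I. f i \<in> hom C x (a i)) \<longrightarrow>
          (\<exists>!k. k \<in> hom C x c \<and> (\<forall>i\<in>I. p i \<cdot>\<^bsub>C\<^esub> k = f i)))"
    (is "(\<forall>f. ?R f) \<longleftrightarrow> (\<forall>f. ?S f)") for x
  proof -
    have "(\<forall>f. ?R (\<lambda>j. f (h j))) \<longleftrightarrow> (\<forall>f. ?R f)"
      by (rule all) simp
    moreover have "?R (\<lambda>j. f (h j)) \<longleftrightarrow> ?S f" for f
      using ball[of "\<lambda>i. f i \<in> hom C x (a i)"] ball[of "\<lambda>i. p i \<cdot>\<^bsub>C\<^esub> k = f i" for k] by simp
    ultimately show ?thesis by simp
  qed
  then show ?thesis
    by (simp add: is_product_def ball[of "\<lambda>i. a i \<in> Obj C"] ball[of "\<lambda>i. p i \<in> hom C c (a i)"])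
qed

text \<open>As \<open>r\<close> is a cardinal order, it has the size of its field, so
  \<open>I\<close> embeds into \<open>Field r\<close>. The image is a set over \<open>'r\<close>,
  and the inverse of the embedding is the required bijection.\<close>

lemma small_set_reindex:
  fixes r :: "'r rel" and I :: "'i set"
  assumes "Card_order r" "|I| <o r"
  obtains J :: "'r set" and h where "bij_betw h J I" "|J| <o r"
proof -
  have "|I| \<le>o |Field r|"
    by (rule ordLeq_ordIso_trans[OF ordLess_imp_ordLeq[OF assms(2)]
          ordIso_symmetric[OF card_of_Field_ordIso[OF assms(1)]]])
  then obtain f where f: "inj_on f I" "f ` I \<subseteq> Field r"
    unfolding card_of_ordLeq[symmetric] by blast
  have "|f ` I| <o r"
    by (rule ordLeq_ordLess_trans[OF card_of_image assms(2)])
  then show thesis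
    by (rule that[OF bij_betw_inv_into[OF inj_on_imp_bij_betw[OF f(1)]]])
qed

text \<open>Products are assumed only for index sets over \<open>'r\<close>, while the argument
  needs them over \<open>'i\<close> and over \<open>bool\<close>. Reindexing along a bijection
  bridges the gap.\<close>

lemma has_products_below_transfer:
  fixes r :: "'r rel"
  assumes "Card_order r" "has_products_below TYPE('r) r B"
  shows "has_products_below TYPE('i) r B"
  unfolding has_products_below_def
proof (intro allI impI)
  fix I :: "'i set" and a
  assume "|I| <o r" and a: "\<forall>i\<in>I. a i \<in> Obj B"
  then obtain J :: "'r set" and h where h: "bij_betw h J I" "|J| <o r"
    using small_set_reindex[OF assms(1)] by blast
  have "\<forall>j\<in>J. a (h j) \<in> Obj B" using a bij_betwE[OF h(1)] by auto
  then obtain c p where "is_product B J (\<lambda>j. a (h j)) c p"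
    using assms(2)[unfolded has_products_below_def] h(2) by meson
  \<comment> \<open>The projections have to be rewritten as a family that factors through
    \<open>h\<close> before the reindexing lemma applies.\<close>
  moreover have "p j = p (inv_into J h (h j))" if "j \<in> J" for j
    using bij_betw_inv_into_left[OF h(1) that] by simp
  ultimately have "is_product B J (\<lambda>j. a (h j)) c (\<lambda>j. p (inv_into J h (h j)))"
    by (simp add: is_product_def)
  then show "\<exists>c p. is_product B I a c p"
    using is_product_reindex[OF h(1), of B a c "\<lambda>i. p (inv_into J h i)"] by blast
qed

lemma preserves_products_below_transfer:
  fixes r :: "'r rel"
  assumes "Card_order r" "preserves_products_below TYPE('r) r B D G"
  shows "preserves_products_below TYPE('i) r B D G"
  unfolding preserves_products_below_def
proof (intro allI impI)
  fix I :: "'i set" and a c p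
  assume "|I| <o r" and P: "is_product B I a c p"
  then obtain J :: "'r set" and h where h: "bij_betw h J I" "|J| <o r"
    using small_set_reindex[OF assms(1)] by blast
  from P have "is_product B J (\<lambda>j. a (h j)) c (\<lambda>j. p (h j))"
    by (simp add: is_product_reindex[OF h(1)])
  then have "is_product D J (\<lambda>j. FObj G (a (h j))) (FObj G c) (\<lambda>j. FArr G (p (h j)))"
    using assms(2)[unfolded preserves_products_below_def] h(2) by meson
  then show "is_product D I (\<lambda>i. FObj G (a i)) (FObj G c) (\<lambda>i. FArr G (p i))"
    using is_product_reindex[OF h(1), of D "\<lambda>i. FObj G (a i)" "FObj G c" "\<lambda>i. FArr G (p i)"] by simp
qed

section \<open>Set-valued functors\<close>

abbreviation act :: "('o, 'm, 'u set, 'u set_arrow) fctr \<Rightarrow> 'm \<Rightarrow> 'u \<Rightarrow> 'u" where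
  "act X f \<equiv> fun_of (FArr X f)"

context
  fixes B :: "('o, 'm, 'e) category_scheme" and X :: "('o, 'm, 'u set, 'u set_arrow) fctr"
  assumes X: "cat_functor B set_cat X"
begin

interpretation cat_functor B set_cat X by (rule X)

lemma act_in: "f \<in> hom B b b' \<Longrightarrow> x \<in> FObj X b \<Longrightarrow> act X f x \<in> FObj X b'"
  using in_hom_set_catD(2)[OF FArr_in_hom] by auto

lemma act_Ide: "b \<in> Obj B \<Longrightarrow> x \<in> FObj X b \<Longrightarrow> act X (Ide B b) x = x"
  by (simp add: FArr_Ide) (simp add: set_cat_def fun_of_def)

lemma act_Cmp:
  assumes "f \<in> hom B b b'" "g \<in> hom B b' b''" "x \<in> FObj X b"
  shows "act X (g \<cdot>\<^bsub>B\<^esub> f) x = act X g (act X f x)"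
proof -
  have "fst (FArr X f) = FObj X b" using in_hom_set_catD(1)[OF FArr_in_hom[OF assms(1)]] by (metis fst_conv)
  then show ?thesis using assms(3)
    by (simp add: FArr_Cmp[OF assms(1,2)]) (simp add: set_cat_def fun_of_def compose_def)
qed

end

text \<open>The bijection onto the extensional product, read off element by element. The family
  \<open>x\<close> may be arbitrary outside \<open>I\<close>, hence the use of
  \<open>restrict x I\<close>.\<close>

lemma is_product_set_cat_ex1:
  assumes P: "is_product set_cat I a c p" and x: "\<And>i. i \<in> I \<Longrightarrow> x i \<in> a i"
  shows "\<exists>!y. y \<in> c \<and> (\<forall>i\<in>I. fun_of (p i) y = x i)"
proof -
  have bij: "bij_betw (\<lambda>y. \<lambda>i\<in>I. fun_of (p i) y) c (\<Pi>\<^sub>E i\<in>I. a i)"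
    using P by (simp add: is_product_set_cat_iff)
  have iff: "(\<lambda>i\<in>I. fun_of (p i) y) = restrict x I \<longleftrightarrow> (\<forall>i\<in>I. fun_of (p i) y = x i)" for y
    by (auto simp: fun_eq_iff restrict_def)
  have "restrict x I \<in> (\<lambda>y. \<lambda>i\<in>I. fun_of (p i) y) ` c"
    using x by (simp add: bij_betw_imp_surj_on[OF bij])
  then obtain y where y: "y \<in> c" "(\<lambda>i\<in>I. fun_of (p i) y) = restrict x I" by auto
  show ?thesis
  proof (rule ex1I[of _ y])
    show "y' = y" if "y' \<in> c \<and> (\<forall>i\<in>I. fun_of (p i) y' = x i)" for y'
      using inj_onD[OF bij_betw_imp_inj_on[OF bij], of y' y] that y by (simp add: iff)
  qed (use y iff in blast)
qed

text \<open>When \<open>X\<close> preserves a product, its elements there are families of elements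
  at the factors. The first part serves to build elements, the second to prove them equal.\<close>

lemma is_product_FArr_joint:
  assumes pres: "is_product set_cat I (\<lambda>i. FObj X (a i)) (FObj X c) (\<lambda>i. FArr X (p i))"
  shows "(\<And>i. i \<in> I \<Longrightarrow> x i \<in> FObj X (a i)) \<Longrightarrow> \<exists>y\<in>FObj X c. \<forall>i\<in>I. act X (p i) y = x i"
    and "y \<in> FObj X c \<Longrightarrow> y' \<in> FObj X c \<Longrightarrow> (\<And>i. i \<in> I \<Longrightarrow> act X (p i) y = act X (p i) y') \<Longrightarrow> y = y'"
proof -
  show "\<exists>y\<in>FObj X c. \<forall>i\<in>I. act X (p i) y = x i" if "\<And>i. i \<in> I \<Longrightarrow> x i \<in> FObj X (a i)"
    using is_product_set_cat_ex1[OF pres, of x] that by blast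
  assume y: "y \<in> FObj X c" "y' \<in> FObj X c" and eq: "\<And>i. i \<in> I \<Longrightarrow> act X (p i) y = act X (p i) y'"
  have "act X (p i) y' \<in> FObj X (a i)" if "i \<in> I" for i
    using pres that y(2) in_hom_set_catD(2)[of "FArr X (p i)"] by (auto simp: is_product_def)
  from is_product_set_cat_ex1[OF pres this] y eq show "y = y'" by blast
qed

text \<open>In sets, a weak pullback is a commutative square whose vertex maps onto the set of
  compatible pairs. This is the Weak Pullback Condition for \<open>X\<close> in that form; one
  square serves all compatible pairs over its cospan.\<close>

definition elementwise_wpc ::
  "('o, 'm, 'e) category_scheme \<Rightarrow> ('o, 'm, 'u set, 'u set_arrow) fctr \<Rightarrow> bool" where
  "elementwise_wpc B X \<longleftrightarrow>
     (\<forall>f g b b' c. f \<in> hom B b c \<longrightarrow> g \<in> hom B b' c \<longrightarrow>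
       (\<exists>w p q. p \<in> hom B w b \<and> q \<in> hom B w b' \<and> f \<cdot>\<^bsub>B\<^esub> p = g \<cdot>\<^bsub>B\<^esub> q \<and>
         (\<forall>x\<in>FObj X b. \<forall>x'\<in>FObj X b'. act X f x = act X g x' \<longrightarrow>
            (\<exists>y\<in>FObj X w. act X p y = x \<and> act X q y = x'))))"

lemma elementwise_wpcE:
  assumes "elementwise_wpc B X" "f \<in> hom B b c" "g \<in> hom B b' c"
    "x \<in> FObj X b" "x' \<in> FObj X b'" "act X f x = act X g x'"
  obtains w p q y where "p \<in> hom B w b" "q \<in> hom B w b'" "f \<cdot>\<^bsub>B\<^esub> p = g \<cdot>\<^bsub>B\<^esub> q"
    "y \<in> FObj X w" "act X p y = x" "act X q y = x'"
  using assms unfolding elementwise_wpc_def by metis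

section \<open>Representable functors composed with \<open>G\<close>\<close>

lemma FObj_hom_functor: "FObj (fctr_comp (hom_functor D d) G) b = hom D d (FObj G b)"
  by (simp add: fctr_comp_def hom_functor_def)

lemma act_hom_functor:
  assumes "k \<in> hom D x y" "h \<in> hom D d x"
  shows "act (hom_functor D d) k h = k \<cdot>\<^bsub>D\<^esub> h"
  using assms by (simp add: hom_functor_def fun_of_def hom_def)

lemma act_comp_hom_functor:
  assumes "cat_functor B D G" "k \<in> hom B x y" "h \<in> hom D d (FObj G x)"
  shows "act (fctr_comp (hom_functor D d) G) k h = FArr G k \<cdot>\<^bsub>D\<^esub> h"
  using act_hom_functor[OF cat_functor.FArr_in_hom[OF assms(1,2)] assms(3)]
  by (simp add: fctr_comp_def)

text \<open>A compatible pair of elements is a pair of arrows out of \<open>d\<close> forming a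
  commutative square over the image of the cospan under \<open>G\<close>. The weak pullback property
  in \<open>D\<close> factors it through \<open>FObj G w\<close>, and the factorisation is the
  element sought.\<close>

lemma elementwise_wpc_hom_functor:
  assumes G: "cat_functor B D G" and wpc: "weak_pullback_condition B D G"
  shows "elementwise_wpc B (fctr_comp (hom_functor D d) G)"
  unfolding elementwise_wpc_def
proof (intro allI impI)
  interpret G: cat_functor B D G by fact
  let ?X = "fctr_comp (hom_functor D d) G"
  fix f g b b' c assume f: "f \<in> hom B b c" and g: "g \<in> hom B b' c"
  then obtain p q where sq: "commutative_square B f g p q"
    and wp: "weak_pullback D (FArr G f) (FArr G g) (FArr G p) (FArr G q)"
    using wpc unfolding weak_pullback_condition_def by (metis homD)
  obtain w where p: "p \<in> hom B w b" and q: "q \<in> hom B w b'" and eq: "f \<cdot>\<^bsub>B\<^esub> p = g \<cdot>\<^bsub>B\<^esub> q"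
    using sq f g unfolding commutative_square_def by (metis homD)
  note Gh = f[THEN G.FArr_in_hom] g[THEN G.FArr_in_hom] p[THEN G.FArr_in_hom] q[THEN G.FArr_in_hom]
  have "\<exists>y\<in>FObj ?X w. act ?X p y = x \<and> act ?X q y = x'"
    if x: "x \<in> FObj ?X b" and x': "x' \<in> FObj ?X b'" and xx: "act ?X f x = act ?X g x'" for x x'
  proof -
    have x: "x \<in> hom D d (FObj G b)" and x': "x' \<in> hom D d (FObj G b')"
      using x x' by (simp_all add: FObj_hom_functor)
    have "commutative_square D (FArr G f) (FArr G g) x x'"
      using xx x x' Gh unfolding commutative_square_def
      by (auto simp: act_comp_hom_functor[OF G f x] act_comp_hom_functor[OF G g x'])
    then obtain y where y: "y \<in> hom D (Dom D x) (Dom D (FArr G p))"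
      "FArr G p \<cdot>\<^bsub>D\<^esub> y = x" "FArr G q \<cdot>\<^bsub>D\<^esub> y = x'"
      using wp unfolding weak_pullback_def by blast
    then have "y \<in> hom D d (FObj G w)" using homD[OF x] homD[OF Gh(3)] by simp
    with y show ?thesis
      by (auto simp: FObj_hom_functor act_comp_hom_functor[OF G p] act_comp_hom_functor[OF G q])
  qed
  with p q eq show "\<exists>w p q. p \<in> hom B w b \<and> q \<in> hom B w b' \<and> f \<cdot>\<^bsub>B\<^esub> p = g \<cdot>\<^bsub>B\<^esub> q \<and>
      (\<forall>x\<in>FObj ?X b. \<forall>x'\<in>FObj ?X b'. act ?X f x = act ?X g x' \<longrightarrow>
        (\<exists>y\<in>FObj ?X w. act ?X p y = x \<and> act ?X q y = x'))" by blast
qed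

text \<open>The universal property of the product, tested at the vertex \<open>d\<close>, says
  precisely that composing with the projections is a bijection.\<close>

lemma is_product_hom_functor:
  assumes D: "category D" and d: "d \<in> Obj D" and P: "is_product D I a c p"
  shows "is_product set_cat I (\<lambda>i. FObj (hom_functor D d) (a i)) (FObj (hom_functor D d) c)
           (\<lambda>i. FArr (hom_functor D d) (p i))"
  unfolding is_product_set_cat_iff
proof
  interpret category D by fact
  interpret H: cat_functor D set_cat "hom_functor D d" by (rule cat_functor_hom_functor[OF D d])
  let ?H = "hom_functor D d"
  have p: "p i \<in> hom D c (a i)" if "i \<in> I" for i using P that by (simp add: is_product_def)
  then show "\<forall>i\<in>I. FArr ?H (p i) \<in> hom set_cat (FObj ?H c) (FObj ?H (a i))"
    by (simp add: H.FArr_in_hom)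
  have FO: "FObj ?H x = hom D d x" for x by (simp add: hom_functor_def)
  note ac = act_hom_functor[OF p]
  show "bij_betw (\<lambda>h. \<lambda>i\<in>I. act ?H (p i) h) (FObj ?H c) (\<Pi>\<^sub>E i\<in>I. FObj ?H (a i))"
  proof (rule bij_betwI')
    fix h k assume "h \<in> FObj ?H c" "k \<in> FObj ?H c"
    then have hk: "h \<in> hom D d c" "k \<in> hom D d c" by (simp_all add: FO)
    show "(\<lambda>i\<in>I. act ?H (p i) h) = (\<lambda>i\<in>I. act ?H (p i) k) \<longleftrightarrow> h = k"
    proof
      assume eq: "(\<lambda>i\<in>I. act ?H (p i) h) = (\<lambda>i\<in>I. act ?H (p i) k)"
      show "h = k"
      proof (rule is_product_cancel[OF P D hk])
        fix i assume i: "i \<in> I"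
        then show "p i \<cdot>\<^bsub>D\<^esub> h = p i \<cdot>\<^bsub>D\<^esub> k" using fun_cong[OF eq, of i] ac[OF i] hk by simp
      qed
    qed simp
  next
    fix h assume "h \<in> FObj ?H c"
    then show "(\<lambda>i\<in>I. act ?H (p i) h) \<in> (\<Pi>\<^sub>E i\<in>I. FObj ?H (a i))"
      by (auto simp: FO ac intro: Cmp_in_hom[OF _ p])
  next
    fix y assume y: "y \<in> (\<Pi>\<^sub>E i\<in>I. FObj ?H (a i))"
    then have "y i \<in> hom D d (a i)" if "i \<in> I" for i using that by (auto simp: FO)
    then obtain h where h: "h \<in> hom D d c" "\<And>i. i \<in> I \<Longrightarrow> p i \<cdot>\<^bsub>D\<^esub> h = y i"
      using is_product_lift[OF P d] by blast
    then have "y = (\<lambda>i\<in>I. act ?H (p i) h)"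
      using y by (auto simp: ac fun_eq_iff PiE_iff extensional_def)
    then show "\<exists>h\<in>FObj ?H c. y = (\<lambda>i\<in>I. act ?H (p i) h)" using h(1) FO by blast
  qed
qed

section \<open>Merging spans\<close>

text \<open>The legs of the merged span factor through every given span by the arrows
  \<open>g i\<close>, so an equation that holds along each given span separately passes to the
  merged one. For empty \<open>I\<close> the lemma still yields a span joining \<open>x\<close> and
  \<open>x'\<close>.\<close>

lemma merge_spans:
  fixes B :: "('o, 'm, 'e) category_scheme" and X :: "('o, 'm, 'u set, 'u set_arrow) fctr"
    and I :: "'i set"
  assumes X: "cat_functor B set_cat X" and wpc: "elementwise_wpc B X"
    and prod: "has_products_below TYPE('i) r B" "preserves_products_below TYPE('i) r B set_cat X"
    and prod2: "has_products_below TYPE(bool) r B" "preserves_products_below TYPE(bool) r B set_cat X"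
    and I: "|I| <o r" and bool: "|UNIV :: bool set| <o r"
    and b: "b \<in> Obj B" "b' \<in> Obj B" and x: "x \<in> FObj X b" "x' \<in> FObj X b'"
    and span: "\<And>i. i \<in> I \<Longrightarrow> p i \<in> hom B (w i) b \<and> q i \<in> hom B (w i) b' \<and>
          y i \<in> FObj X (w i) \<and> act X (p i) (y i) = x \<and> act X (q i) (y i) = x'"
  obtains W P Q Y g where "P \<in> hom B W b" "Q \<in> hom B W b'" "Y \<in> FObj X W" "act X P Y = x" "act X Q Y = x'"
    "\<And>i. i \<in> I \<Longrightarrow> g i \<in> hom B W (w i) \<and> p i \<cdot>\<^bsub>B\<^esub> g i = P \<and> q i \<cdot>\<^bsub>B\<^esub> g i = Q"
proof -
  interpret X: cat_functor B set_cat X by (rule X)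
  have w: "w i \<in> Obj B" if "i \<in> I" for i
    using homD[of "p i" B] span[OF that] X.B.Dom_in_Obj by metis
  obtain v \<pi> where v: "is_product B I w v \<pi>"
    using prod(1) I w unfolding has_products_below_def by blast
  \<comment> \<open>The binary product of \<open>b\<close> and \<open>b'\<close>, written as a
    product over \<open>bool\<close>, will be \<open>s\<close>.\<close>
  define a where "a t = (if t then b else b')" for t
  have "\<forall>t\<in>UNIV. a t \<in> Obj B" using b by (simp add: a_def)
  then obtain s \<sigma> where s: "is_product B UNIV a s \<sigma>"
    using prod2(1) bool unfolding has_products_below_def by blast
  have so: "s \<in> Obj B" and \<sigma>: "\<sigma> t \<in> hom B s (a t)" for t
    using s by (auto simp: is_product_def)
  have vo: "v \<in> Obj B" and \<pi>: "i \<in> I \<Longrightarrow> \<pi> i \<in> hom B v (w i)" for i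
    using v by (auto simp: is_product_def)
  \<comment> \<open>\<open>m\<close> is the power of \<open>s\<close> by \<open>I\<close>, the
    target of the cospan to be completed.\<close>
  obtain m \<mu> where m: "is_product B I (\<lambda>_. s) m \<mu>"
    using prod(1)[unfolded has_products_below_def, rule_format, OF I, of "\<lambda>_. s"] so by blast
  have \<mu>: "i \<in> I \<Longrightarrow> \<mu> i \<in> hom B m s" for i
    using m by (auto simp: is_product_def)
  note Xv = prod(2)[unfolded preserves_products_below_def, rule_format, OF I v]
    and Xm = prod(2)[unfolded preserves_products_below_def, rule_format, OF I m]
    and Xs = prod2(2)[unfolded preserves_products_below_def, rule_format, OF bool s]
  have "\<exists>k. k \<in> hom B (w i) s \<and> \<sigma> True \<cdot>\<^bsub>B\<^esub> k = p i \<and> \<sigma> False \<cdot>\<^bsub>B\<^esub> k = q i" if i: "i \<in> I" for i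
  proof -
    have "(if t then p i else q i) \<in> hom B (w i) (a t)" for t
      using span[OF i] by (simp add: a_def)
    then obtain k where "k \<in> hom B (w i) s" "\<And>t. \<sigma> t \<cdot>\<^bsub>B\<^esub> k = (if t then p i else q i)"
      using is_product_lift[OF s w[OF i], of "\<lambda>t. if t then p i else q i"] by (metis UNIV_I)
    then show ?thesis by auto
  qed
  then obtain k where k: "k i \<in> hom B (w i) s" and \<sigma>k: "\<sigma> True \<cdot>\<^bsub>B\<^esub> k i = p i" "\<sigma> False \<cdot>\<^bsub>B\<^esub> k i = q i"
    if "i \<in> I" for i by metis
  \<comment> \<open>\<open>K\<close> is the product of the pairings \<open>k i\<close> of
    \<open>p i\<close> and \<open>q i\<close>; \<open>\<Delta>\<close> below is the diagonal of
    \<open>s\<close>.\<close>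
  obtain K where K: "K \<in> hom B v m" and \<mu>K: "\<And>i. i \<in> I \<Longrightarrow> \<mu> i \<cdot>\<^bsub>B\<^esub> K = k i \<cdot>\<^bsub>B\<^esub> \<pi> i"
    using is_product_lift[OF m vo, of "\<lambda>i. k i \<cdot>\<^bsub>B\<^esub> \<pi> i"] X.B.Cmp_in_hom[OF \<pi> k] by blast
  obtain \<Delta> where \<Delta>: "\<Delta> \<in> hom B s m" and \<mu>\<Delta>: "\<And>i. i \<in> I \<Longrightarrow> \<mu> i \<cdot>\<^bsub>B\<^esub> \<Delta> = Ide B s"
    using is_product_lift[OF m so, of "\<lambda>_. Ide B s"] X.B.Ide_in_hom[OF so] by blast
  obtain yv where yv: "yv \<in> FObj X v" "\<And>i. i \<in> I \<Longrightarrow> act X (\<pi> i) yv = y i"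
    using is_product_FArr_joint(1)[OF Xv, of y] span by blast
  have "(if t then x else x') \<in> FObj X (a t)" for t using x by (simp add: a_def)
  then obtain xs where xs: "xs \<in> FObj X s" "\<And>t. act X (\<sigma> t) xs = (if t then x else x')"
    using is_product_FArr_joint(1)[OF Xs, of "\<lambda>t. if t then x else x'"] by auto
  \<comment> \<open>\<open>xs\<close> is the pair of \<open>x\<close> and \<open>x'\<close>. Since
    \<open>k i\<close> pairs \<open>p i\<close> with \<open>q i\<close>, the two elements agree on
    both projections.\<close>
  have kxs: "act X (k i) (y i) = xs" if i: "i \<in> I" for i
  proof (rule is_product_FArr_joint(2)[OF Xs])
    fix t
    show "act X (\<sigma> t) (act X (k i) (y i)) = act X (\<sigma> t) xs"
      using span[OF i] \<sigma>k[OF i] act_Cmp[OF X k[OF i] \<sigma>[of t], of "y i"] xs(2)[of t]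
      by (cases t) auto
  qed (use act_in[OF X k[OF i]] span[OF i] xs in auto)
  \<comment> \<open>Both sides have every coordinate equal to \<open>xs\<close>, so
    \<open>yv\<close> and \<open>xs\<close> form a compatible pair over the cospan of
    \<open>K\<close> and \<open>\<Delta>\<close>.\<close>
  have "act X K yv = act X \<Delta> xs"
  proof (rule is_product_FArr_joint(2)[OF Xm act_in[OF X K yv(1)] act_in[OF X \<Delta> xs(1)]])
    fix i assume i: "i \<in> I"
    have "act X (\<mu> i) (act X K yv) = xs"
      using act_Cmp[OF X K \<mu>[OF i] yv(1)] act_Cmp[OF X \<pi>[OF i] k[OF i] yv(1)] kxs[OF i] yv(2)[OF i] \<mu>K[OF i]
      by simp
    moreover have "act X (\<mu> i) (act X \<Delta> xs) = xs"
      using act_Cmp[OF X \<Delta> \<mu>[OF i] xs(1)] \<mu>\<Delta>[OF i] act_Ide[OF X so xs(1)] by simp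
    ultimately show "act X (\<mu> i) (act X K yv) = act X (\<mu> i) (act X \<Delta> xs)" by simp
  qed
  then obtain W g h Y where g: "g \<in> hom B W v" and h: "h \<in> hom B W s" and gh: "K \<cdot>\<^bsub>B\<^esub> g = \<Delta> \<cdot>\<^bsub>B\<^esub> h"
    and Y: "Y \<in> FObj X W" "act X g Y = yv" "act X h Y = xs"
    using elementwise_wpcE[OF wpc K \<Delta> yv(1) xs(1)] by metis
  \<comment> \<open>The coordinate \<open>i\<close> of the commutative square. On the diagonal side
    it is \<open>h\<close>, whatever \<open>i\<close> is, and this is what makes the merged legs
    independent of \<open>i\<close>.\<close>
  have kg: "k i \<cdot>\<^bsub>B\<^esub> (\<pi> i \<cdot>\<^bsub>B\<^esub> g) = h" if i: "i \<in> I" for i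
  proof -
    have "k i \<cdot>\<^bsub>B\<^esub> (\<pi> i \<cdot>\<^bsub>B\<^esub> g) = \<mu> i \<cdot>\<^bsub>B\<^esub> (K \<cdot>\<^bsub>B\<^esub> g)"
      using X.B.Cmp_assoc[OF g \<pi>[OF i] k[OF i]] X.B.Cmp_assoc[OF g K \<mu>[OF i]] \<mu>K[OF i] by simp
    also have "\<dots> = h"
      using X.B.Cmp_assoc[OF h \<Delta> \<mu>[OF i]] gh \<mu>\<Delta>[OF i] X.B.Ide_left[OF h] by simp
    finally show ?thesis .
  qed
  show thesis
  proof (rule that[of "\<sigma> True \<cdot>\<^bsub>B\<^esub> h" W "\<sigma> False \<cdot>\<^bsub>B\<^esub> h" Y "\<lambda>i. \<pi> i \<cdot>\<^bsub>B\<^esub> g"])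
    show "\<sigma> True \<cdot>\<^bsub>B\<^esub> h \<in> hom B W b" "\<sigma> False \<cdot>\<^bsub>B\<^esub> h \<in> hom B W b'"
      using X.B.Cmp_in_hom[OF h \<sigma>[of True]] X.B.Cmp_in_hom[OF h \<sigma>[of False]] by (simp_all add: a_def)
    show "act X (\<sigma> True \<cdot>\<^bsub>B\<^esub> h) Y = x" "act X (\<sigma> False \<cdot>\<^bsub>B\<^esub> h) Y = x'"
      using act_Cmp[OF X h \<sigma> Y(1)] Y(3) xs(2) by simp_all
    fix i assume i: "i \<in> I"
    note \<pi>g = X.B.Cmp_in_hom[OF g \<pi>[OF i]]
    show "\<pi> i \<cdot>\<^bsub>B\<^esub> g \<in> hom B W (w i) \<and> p i \<cdot>\<^bsub>B\<^esub> (\<pi> i \<cdot>\<^bsub>B\<^esub> g) = \<sigma> True \<cdot>\<^bsub>B\<^esub> h \<and>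
        q i \<cdot>\<^bsub>B\<^esub> (\<pi> i \<cdot>\<^bsub>B\<^esub> g) = \<sigma> False \<cdot>\<^bsub>B\<^esub> h"
      using X.B.Cmp_assoc[OF \<pi>g k[OF i] \<sigma>] \<pi>g kg[OF i] \<sigma>k[OF i] by metis
  qed (rule Y(1))
qed

section \<open>Equality of classes in the Kan extension\<close>

text \<open>The vertex \<open>w\<close> carries no structure arrow of its own: it is the common
  value of the two composites in the equation between \<open>z\<close> and \<open>z'\<close>. Taking
  whole elements as arguments suits the induction along a zigzag.\<close>

definition connected_by_span ::
  "('o, 'm, 'e) category_scheme \<Rightarrow> ('o2, 'm2, 'e2) category_scheme \<Rightarrow> ('o, 'm, 'o2, 'm2) fctr \<Rightarrow>
     ('o, 'm, 'u set, 'u set_arrow) fctr \<Rightarrow> ('o \<times> 'm2) \<times> 'u \<Rightarrow> ('o \<times> 'm2) \<times> 'u \<Rightarrow> bool" where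
  "connected_by_span B C F X = (\<lambda>((b, z), x) ((b', z'), x').
     \<exists>w p q y. p \<in> hom B w b \<and> q \<in> hom B w b' \<and> z \<cdot>\<^bsub>C\<^esub> FArr F p = z' \<cdot>\<^bsub>C\<^esub> FArr F q \<and>
       y \<in> FObj X w \<and> act X p y = x \<and> act X q y = x')"

abbreviation lan_class ::
  "('o, 'm, 'e) category_scheme \<Rightarrow> ('o2, 'm2, 'e2) category_scheme \<Rightarrow> ('o, 'm, 'o2, 'm2) fctr \<Rightarrow>
     ('o, 'm, 'u set, 'u set_arrow) fctr \<Rightarrow> 'o2 \<Rightarrow> 'o \<Rightarrow> 'm2 \<Rightarrow> 'u \<Rightarrow> (('o \<times> 'm2) \<times> 'u) set" where
  "lan_class B C F X c b z x \<equiv> colim_inj (comma B C F c) (comma_diagram X) (b, z) x"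

context
  fixes B :: "('o, 'm, 'e) category_scheme" and C :: "('o2, 'm2, 'e2) category_scheme"
    and F and X :: "('o, 'm, 'u set, 'u set_arrow) fctr"
  assumes F: "cat_functor B C F" and X: "cat_functor B set_cat X"
begin

interpretation F: cat_functor B C F by (rule F)

text \<open>The cocone identity of the colimit at the comma arrow that \<open>f\<close> defines from
  \<open>b\<close> with the composite structure arrow to \<open>b'\<close> with
  \<open>z\<close>.\<close>

lemma lan_class_act:
  assumes "f \<in> hom B b b'" "z \<in> hom C (FObj F b') c" "x \<in> FObj X b"
  shows "lan_class B C F X c b' z (act X f x) = lan_class B C F X c b (z \<cdot>\<^bsub>C\<^esub> FArr F f) x"
proof -
  have "((b, z \<cdot>\<^bsub>C\<^esub> FArr F f), f, (b', z)) \<in> Arr (comma B C F c)"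
    using assms homD[OF assms(1)] F.B.Dom_in_Obj F.B.Cod_in_Obj
      F.C.Cmp_in_hom[OF F.FArr_in_hom[OF assms(1)] assms(2)] by (auto simp: comma_def)
  from colim_inj_cocone(2)[OF cat_functor_comma_diagram[OF F X] this, of x] assms(3)
  show ?thesis by (simp add: comma_def fctr_comp_def comma_forget_def)
qed

lemma FArr_Cmp_absorb:
  assumes "f \<in> hom B b b'" "g \<in> hom B b' b''" "z \<in> hom C (FObj F b'') c"
  shows "z \<cdot>\<^bsub>C\<^esub> FArr F (g \<cdot>\<^bsub>B\<^esub> f) = z \<cdot>\<^bsub>C\<^esub> FArr F g \<cdot>\<^bsub>C\<^esub> FArr F f"
  using F.C.Cmp_assoc[OF F.FArr_in_hom[OF assms(1)] F.FArr_in_hom[OF assms(2)] assms(3)]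
  by (simp add: F.FArr_Cmp[OF assms(1,2)])

text \<open>Induction along the zigzag. A forward step prolongs the right leg of the span; a
  backward step leaves a cospan, which the elementwise Weak Pullback Condition turns back into a
  span.\<close>

lemma connected_by_span_of_zigzag:
  assumes wpc: "elementwise_wpc B X"
    and e: "e \<in> colim_elems (comma B C F c) (comma_diagram X)"
    and zig: "(e, e') \<in> (colim_step (comma B C F c) (comma_diagram X) \<union>
                 (colim_step (comma B C F c) (comma_diagram X))\<inverse>)\<^sup>*"
  shows "connected_by_span B C F X e e'"
  using zig
proof (induction rule: rtrancl_induct)
  case base
  obtain b z x where ee: "e = ((b, z), x)" by (metis surj_pair)
  then have b: "b \<in> Obj B" and x: "x \<in> FObj X b"
    using e by (auto simp: colim_elems_def comma_def fctr_comp_def comma_forget_def)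
  show ?case
    unfolding ee connected_by_span_def prod.case
    by (intro exI[of _ b] exI[of _ "Ide B b"] exI[of _ x])
      (simp add: F.B.Ide_in_hom[OF b] act_Ide[OF X b x] x)
next
  case (step v v')
  obtain b z x where ee: "e = ((b, z), x)" by (metis surj_pair)
  have z: "z \<in> hom C (FObj F b) c"
    using e by (auto simp: ee colim_elems_def comma_def)
  obtain b1 z1 x1 where vv: "v = ((b1, z1), x1)" by (metis surj_pair)
  obtain b2 z2 x2 where vv': "v' = ((b2, z2), x2)" by (metis surj_pair)
  obtain w p q y where p: "p \<in> hom B w b" and q: "q \<in> hom B w b1"
    and pq: "z \<cdot>\<^bsub>C\<^esub> FArr F p = z1 \<cdot>\<^bsub>C\<^esub> FArr F q"
    and y: "y \<in> FObj X w" "act X p y = x" "act X q y = x1"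
    using step.IH unfolding ee vv connected_by_span_def by auto
  from step.hyps(2) consider
      f where "f \<in> hom B b1 b2" "z2 \<cdot>\<^bsub>C\<^esub> FArr F f = z1" "z2 \<in> hom C (FObj F b2) c" "act X f x1 = x2"
    | f where "f \<in> hom B b2 b1" "z1 \<cdot>\<^bsub>C\<^esub> FArr F f = z2" "z1 \<in> hom C (FObj F b1) c"
        "x2 \<in> FObj X b2" "act X f x2 = x1"
    unfolding vv vv' colim_step_def comma_def fctr_comp_def comma_forget_def by auto
  then show ?case
  proof cases
    case 1
    then have "z \<cdot>\<^bsub>C\<^esub> FArr F p = z2 \<cdot>\<^bsub>C\<^esub> FArr F (f \<cdot>\<^bsub>B\<^esub> q)"
      using FArr_Cmp_absorb[OF q 1(1) 1(3)] pq by simp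
    moreover have "act X (f \<cdot>\<^bsub>B\<^esub> q) y = x2"
      using act_Cmp[OF X q 1(1) y(1)] y(3) 1(4) by simp
    ultimately show ?thesis
      unfolding ee vv' connected_by_span_def using p y F.B.Cmp_in_hom[OF q 1(1)] by auto
  next
    case 2
    \<comment> \<open>The cospan consists of the right leg \<open>q\<close> and the reversed step
      \<open>f\<close>; \<open>y\<close> and \<open>x2\<close> are compatible over it because both
      are sent to \<open>x1\<close>.\<close>
    obtain w' p' q' y' where sq: "p' \<in> hom B w' w" "q' \<in> hom B w' b2" "q \<cdot>\<^bsub>B\<^esub> p' = f \<cdot>\<^bsub>B\<^esub> q'"
      and y': "y' \<in> FObj X w'" "act X p' y' = y" "act X q' y' = x2"
      using elementwise_wpcE[OF wpc q 2(1) y(1) 2(4)] y(3) 2(5) by metis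
    have "z \<cdot>\<^bsub>C\<^esub> FArr F (p \<cdot>\<^bsub>B\<^esub> p') = z2 \<cdot>\<^bsub>C\<^esub> FArr F q'"
      using FArr_Cmp_absorb[OF sq(1) p z] FArr_Cmp_absorb[OF sq(1) q 2(3)]
        FArr_Cmp_absorb[OF sq(2) 2(1) 2(3)] pq sq(3) 2(2) by simp
    moreover have "act X (p \<cdot>\<^bsub>B\<^esub> p') y' = x"
      using act_Cmp[OF X sq(1) p y'(1)] y'(2) y(2) by simp
    ultimately show ?thesis
      unfolding ee vv' connected_by_span_def using y' sq(2) F.B.Cmp_in_hom[OF sq(1) p] by auto
  qed
qed

lemma lan_class_eq_iff:
  assumes wpc: "elementwise_wpc B X"
    and e: "b \<in> Obj B" "z \<in> hom C (FObj F b) c" "x \<in> FObj X b"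
    and e': "b' \<in> Obj B" "z' \<in> hom C (FObj F b') c" "x' \<in> FObj X b'"
  shows "lan_class B C F X c b z x = lan_class B C F X c b' z' x' \<longleftrightarrow>
    (\<exists>w p q y. p \<in> hom B w b \<and> q \<in> hom B w b' \<and> z \<cdot>\<^bsub>C\<^esub> FArr F p = z' \<cdot>\<^bsub>C\<^esub> FArr F q \<and>
       y \<in> FObj X w \<and> act X p y = x \<and> act X q y = x')" (is "?L = ?R")
proof
  let ?E = "colim_elems (comma B C F c) (comma_diagram X)"
  assume ?L
  moreover have "((b, z), x) \<in> ?E" "((b', z'), x') \<in> ?E"
    using e e' by (auto simp: colim_elems_def comma_def fctr_comp_def comma_forget_def)
  ultimately have "(((b, z), x), ((b', z'), x')) \<in> colim_rel (comma B C F c) (comma_diagram X)"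
    and E: "((b, z), x) \<in> ?E"
    unfolding colim_inj_def using eq_equiv_class[OF _ equiv_colim_rel] by blast+
  then have "connected_by_span B C F X ((b, z), x) ((b', z'), x')"
    using connected_by_span_of_zigzag[OF wpc E] by (simp add: colim_rel_def)
  then show ?R by (simp add: connected_by_span_def)
next
  assume ?R
  \<comment> \<open>Both classes equal the class of \<open>y\<close> at \<open>w\<close>, moved
    along the two legs.\<close>
  then show ?L using lan_class_act e(2) e'(2) by metis
qed

section \<open>Preservation of products\<close>

text \<open>In sets, preservation amounts to bijectivity of the comparison map, so injectivity and
  surjectivity are checked on representatives of classes.\<close>

lemma lan_preserves_products_below:
  assumes wpc: "elementwise_wpc B X"
    and prod: "has_products_below TYPE('i) r B" "preserves_products_below TYPE('i) r B set_cat X"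
    and prod2: "has_products_below TYPE(bool) r B" "preserves_products_below TYPE(bool) r B set_cat X"
    and bool: "|UNIV :: bool set| <o r"
  shows "preserves_products_below TYPE('i) r C set_cat (lan B C F X)"
  unfolding preserves_products_below_def
proof (intro allI impI)
  fix I :: "'i set" and a c \<rho>
  assume I: "|I| <o r" and c: "is_product C I a c \<rho>"
  let ?L = "lan B C F X" and ?cl = "lan_class B C F X"
  have \<rho>: "\<rho> i \<in> hom C c (a i)" if "i \<in> I" for i using c that by (simp add: is_product_def)
  show "is_product set_cat I (\<lambda>i. FObj ?L (a i)) (FObj ?L c) (\<lambda>i. FArr ?L (\<rho> i))"
    unfolding is_product_set_cat_iff
  proof
    show \<rho>L: "\<forall>i\<in>I. FArr ?L (\<rho> i) \<in> hom set_cat (FObj ?L c) (FObj ?L (a i))"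
      using \<rho> FArr_lan_in_hom[OF F X] by blast
    show "bij_betw (\<lambda>K. \<lambda>i\<in>I. fun_of (FArr ?L (\<rho> i)) K) (FObj ?L c) (\<Pi>\<^sub>E i\<in>I. FObj ?L (a i))"
    proof (rule bij_betwI')
      fix K assume "K \<in> FObj ?L c"
      then show "(\<lambda>i\<in>I. fun_of (FArr ?L (\<rho> i)) K) \<in> (\<Pi>\<^sub>E i\<in>I. FObj ?L (a i))"
        using PiE_mem[OF in_hom_set_catD(2)[OF bspec[OF \<rho>L]]] by auto
    next
      fix K K' assume "K \<in> FObj ?L c" and "K' \<in> FObj ?L c"
      then obtain b z x b' z' x' where
        K: "b \<in> Obj B" "z \<in> hom C (FObj F b) c" "x \<in> FObj X b" "K = ?cl c b z x" and
        K': "b' \<in> Obj B" "z' \<in> hom C (FObj F b') c" "x' \<in> FObj X b'" "K' = ?cl c b' z' x'"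
        by (elim lan_elemE[OF F X]) metis
      have "K = K'" if eq: "(\<lambda>i\<in>I. fun_of (FArr ?L (\<rho> i)) K) = (\<lambda>i\<in>I. fun_of (FArr ?L (\<rho> i)) K')"
      proof -
        have "\<exists>w p q y. p \<in> hom B w b \<and> q \<in> hom B w b' \<and>
            (\<rho> i \<cdot>\<^bsub>C\<^esub> z) \<cdot>\<^bsub>C\<^esub> FArr F p = (\<rho> i \<cdot>\<^bsub>C\<^esub> z') \<cdot>\<^bsub>C\<^esub> FArr F q \<and>
            y \<in> FObj X w \<and> act X p y = x \<and> act X q y = x'" if i: "i \<in> I" for i
        proof -
          have "?cl (a i) b (\<rho> i \<cdot>\<^bsub>C\<^esub> z) x = ?cl (a i) b' (\<rho> i \<cdot>\<^bsub>C\<^esub> z') x'"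
            using fun_cong[OF eq, of i] i
            by (simp add: K(4) K'(4) lan_FArr[OF F X \<rho>[OF i] K(1,2,3)] lan_FArr[OF F X \<rho>[OF i] K'(1,2,3)])
          then show ?thesis
            using lan_class_eq_iff[OF wpc K(1) F.C.Cmp_in_hom[OF K(2) \<rho>[OF i]] K(3)
                K'(1) F.C.Cmp_in_hom[OF K'(2) \<rho>[OF i]] K'(3)] by blast
        qed
        \<comment> \<open>One span is chosen for each \<open>i\<close>; the spans for different
          indices are unrelated until they are merged.\<close>
        then obtain w p q y where sp: "\<And>i. i \<in> I \<Longrightarrow> p i \<in> hom B (w i) b \<and> q i \<in> hom B (w i) b' \<and>
            y i \<in> FObj X (w i) \<and> act X (p i) (y i) = x \<and> act X (q i) (y i) = x'"
          and eqi: "\<And>i. i \<in> I \<Longrightarrow> (\<rho> i \<cdot>\<^bsub>C\<^esub> z) \<cdot>\<^bsub>C\<^esub> FArr F (p i) = (\<rho> i \<cdot>\<^bsub>C\<^esub> z') \<cdot>\<^bsub>C\<^esub> FArr F (q i)"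
          by metis
        obtain W P Q Y g where P: "P \<in> hom B W b" and Q: "Q \<in> hom B W b'"
          and Y: "Y \<in> FObj X W" "act X P Y = x" "act X Q Y = x'"
          and g: "\<And>i. i \<in> I \<Longrightarrow> g i \<in> hom B W (w i) \<and> p i \<cdot>\<^bsub>B\<^esub> g i = P \<and> q i \<cdot>\<^bsub>B\<^esub> g i = Q"
          by (rule merge_spans[OF X wpc prod prod2 I bool K(1) K'(1) K(3) K'(3)]) (erule sp, rule that)
        note FP = F.FArr_in_hom[OF P] and FQ = F.FArr_in_hom[OF Q]
        \<comment> \<open>Tested after each projection \<open>\<rho> i\<close>: there
          \<open>P\<close> and \<open>Q\<close> factor through the span chosen for \<open>i\<close>,
          along which the equation is known.\<close>
        have "z \<cdot>\<^bsub>C\<^esub> FArr F P = z' \<cdot>\<^bsub>C\<^esub> FArr F Q"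
        proof (rule is_product_cancel[OF c F.C.category_axioms
              F.C.Cmp_in_hom[OF FP K(2)] F.C.Cmp_in_hom[OF FQ K'(2)]])
          fix i assume i: "i \<in> I"
          have pi: "p i \<in> hom B (w i) b" and qi: "q i \<in> hom B (w i) b'" using sp[OF i] by auto
          have gi: "g i \<in> hom B W (w i)" "p i \<cdot>\<^bsub>B\<^esub> g i = P" "q i \<cdot>\<^bsub>B\<^esub> g i = Q" using g[OF i] by auto
          have "(\<rho> i \<cdot>\<^bsub>C\<^esub> z) \<cdot>\<^bsub>C\<^esub> FArr F P = (\<rho> i \<cdot>\<^bsub>C\<^esub> z') \<cdot>\<^bsub>C\<^esub> FArr F Q"
            using FArr_Cmp_absorb[OF gi(1) pi F.C.Cmp_in_hom[OF K(2) \<rho>[OF i]]]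
              FArr_Cmp_absorb[OF gi(1) qi F.C.Cmp_in_hom[OF K'(2) \<rho>[OF i]]] eqi[OF i] gi by simp
          then show "\<rho> i \<cdot>\<^bsub>C\<^esub> (z \<cdot>\<^bsub>C\<^esub> FArr F P) = \<rho> i \<cdot>\<^bsub>C\<^esub> (z' \<cdot>\<^bsub>C\<^esub> FArr F Q)"
            using F.C.Cmp_assoc[OF FP K(2) \<rho>[OF i]] F.C.Cmp_assoc[OF FQ K'(2) \<rho>[OF i]] by simp
        qed
        then show "K = K'"
          using lan_class_eq_iff[OF wpc K(1,2,3) K'(1,2,3), THEN iffD2] P Q Y unfolding K(4) K'(4)
          by blast
      qed
      then show "(\<lambda>i\<in>I. fun_of (FArr ?L (\<rho> i)) K) = (\<lambda>i\<in>I. fun_of (FArr ?L (\<rho> i)) K') \<longleftrightarrow> K = K'"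
        by blast
    next
      fix \<kappa> assume \<kappa>: "\<kappa> \<in> (\<Pi>\<^sub>E i\<in>I. FObj ?L (a i))"
      have "\<exists>b z x. b \<in> Obj B \<and> z \<in> hom C (FObj F b) (a i) \<and> x \<in> FObj X b \<and> \<kappa> i = ?cl (a i) b z x"
        if "i \<in> I" for i
        using PiE_mem[OF \<kappa> that] by (rule lan_elemE[OF F X]) blast
      then obtain b z x where b: "\<And>i. i \<in> I \<Longrightarrow> b i \<in> Obj B"
        and z: "\<And>i. i \<in> I \<Longrightarrow> z i \<in> hom C (FObj F (b i)) (a i)"
        and x: "\<And>i. i \<in> I \<Longrightarrow> x i \<in> FObj X (b i)"
        and \<kappa>i: "\<And>i. i \<in> I \<Longrightarrow> \<kappa> i = ?cl (a i) (b i) (z i) (x i)"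
        by metis
      obtain v \<pi> where v: "is_product B I b v \<pi>"
        using prod(1) I b unfolding has_products_below_def by blast
      then have vo: "v \<in> Obj B" and \<pi>: "\<And>i. i \<in> I \<Longrightarrow> \<pi> i \<in> hom B v (b i)"
        by (auto simp: is_product_def)
      obtain y where y: "y \<in> FObj X v" "\<And>i. i \<in> I \<Longrightarrow> act X (\<pi> i) y = x i"
        using is_product_FArr_joint(1)[OF prod(2)[unfolded preserves_products_below_def, rule_format, OF I v], of x] x
        by blast
      \<comment> \<open>The tuple of the composites from \<open>FObj F v\<close> through
        \<open>FObj F (b i)\<close> to \<open>a i\<close>, formed by the universal property of
        \<open>c\<close> in \<open>C\<close>. The preimage of \<open>\<kappa>\<close> is the class
        of \<open>y\<close> at \<open>v\<close> with this structure arrow.\<close>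
      obtain \<zeta> where \<zeta>: "\<zeta> \<in> hom C (FObj F v) c" "\<And>i. i \<in> I \<Longrightarrow> \<rho> i \<cdot>\<^bsub>C\<^esub> \<zeta> = z i \<cdot>\<^bsub>C\<^esub> FArr F (\<pi> i)"
        using is_product_lift[OF c F.FObj_in_Obj[OF vo], of "\<lambda>i. z i \<cdot>\<^bsub>C\<^esub> FArr F (\<pi> i)"]
          F.C.Cmp_in_hom[OF F.FArr_in_hom[OF \<pi>] z] by blast
      \<comment> \<open>Composing \<open>\<zeta>\<close> with \<open>\<rho> i\<close> exposes the
        arrow \<open>FArr F (\<pi> i)\<close>, which then moves across the class to act on
        \<open>y\<close> and gives \<open>x i\<close>.\<close>
      have "fun_of (FArr ?L (\<rho> i)) (?cl c v \<zeta> y) = \<kappa> i" if i: "i \<in> I" for i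
        using lan_FArr[OF F X \<rho>[OF i] vo \<zeta>(1) y(1)] \<zeta>(2)[OF i] \<kappa>i[OF i] y(2)[OF i]
          lan_class_act[OF \<pi>[OF i] z[OF i] y(1)] by simp
      then have "\<kappa> = (\<lambda>i\<in>I. fun_of (FArr ?L (\<rho> i)) (?cl c v \<zeta> y))"
        using \<kappa> by (auto simp: fun_eq_iff PiE_iff extensional_def)
      then show "\<exists>K\<in>FObj ?L c. \<kappa> = (\<lambda>i\<in>I. fun_of (FArr ?L (\<rho> i)) K)"
        using lan_inj_in[OF F X vo \<zeta>(1) y(1)] by blast
    qed
  qed
qed

end

section \<open>Specialisation to the functor D(d, G(-))\<close>

theorem theorem4p2:
  fixes r :: "'r rel"
    and B :: "('ob, 'mb) category"
    and C :: "('oc, 'mc) category"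
    and D :: "('od, 'md) category"
    and F :: "('ob, 'mb, 'oc, 'mc) fctr"
    and G :: "('ob, 'mb, 'od, 'md) fctr"
    and d :: 'od
  assumes "Cinfinite r" and "regularCard r"
    and "cat_functor B C F" and "cat_functor B D G"
    and "weak_pullback_condition B D G"
    and "has_products_below TYPE('r) r B"
    and "preserves_products_below TYPE('r) r B D G"
    and "d \<in> Obj D"
  shows "preserves_products_below TYPE('i) r C set_cat (lan B C F (fctr_comp (hom_functor D d) G))"
proof -
  let ?X = "fctr_comp (hom_functor D d) G"
  have r: "Card_order r" using assms(1) by blast
  interpret G: cat_functor B D G by fact
  note D = G.C.category_axioms
  have X: "cat_functor B set_cat ?X"
    by (rule cat_functor_fctr_comp[OF assms(4) cat_functor_hom_functor[OF D assms(8)]])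
  \<comment> \<open>\<open>G\<close> preserves these products by assumption, and the representable
    functor at \<open>d\<close> preserves every product.\<close>
  have pres: "preserves_products_below TYPE('r) r B set_cat ?X"
    unfolding preserves_products_below_def
  proof (intro allI impI)
    fix I :: "'r set" and a c p assume "|I| <o r" "is_product B I a c p"
    then have "is_product D I (\<lambda>i. FObj G (a i)) (FObj G c) (\<lambda>i. FArr G (p i))"
      using assms(7)[unfolded preserves_products_below_def] by blast
    from is_product_hom_functor[OF D assms(8) this]
    show "is_product set_cat I (\<lambda>i. FObj ?X (a i)) (FObj ?X c) (\<lambda>i. FArr ?X (p i))"
      by (simp add: fctr_comp_def)
  qed
  \<comment> \<open>Binary products count as products below \<open>r\<close>, because
    \<open>r\<close> is infinite.\<close>
  have bool: "|UNIV :: bool set| <o r"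
    using assms(1) finite_ordLess_infinite[OF card_of_Well_order[of "UNIV :: bool set"]
        card_order_on_well_order_on[OF r]]
    by (simp add: cinfinite_def Field_card_of)
  note prod = has_products_below_transfer[OF r assms(6)] preserves_products_below_transfer[OF r pres]
  show ?thesis
    by (rule lan_preserves_products_below[OF assms(3) X
          elementwise_wpc_hom_functor[OF assms(4,5)] prod prod bool])
qed

end
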